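(* Let $K=\mathbb{R}$ or $K=\mathbb{C}$, let $d=2$, let $\Sigma\in\mathcal{P}_2(K)$ and let $n\ge 2$ be an integer. Then the density $f_{P\mathcal{W}}(\cdot;\Sigma,n)$ can be factored through a function $h_{\Sigma,n}:\mathbb{R}_+\to\mathbb{R}_+$: for all $x\in\mathcal{S}$, $$f_{P\mathcal{W}}(x;\Sigma,n)=h_{\Sigma,n}\big(\operatorname{dist}(x,\bar\Sigma)\big),$$ where $\bar\Sigma=\frac{1}{\det(\Sigma)^{1/2}}\Sigma$.
   Context: $\mathcal{P}_2(K)$ is the set of $2\times 2$ symmetric positive definite real matrices if $K=\mathbb{R}$, and of $2\times 2$ Hermitian positive definite complex matrices if $K=\mathbb{C}$. $A^*$ denotes the transpose ($K=\mathbb{R}$) or conjugate transpose ($K=\mathbb{C}$) of $A$. $\mathbb{R}_+=[0,\infty)$. Wishart distribution: for $\Sigma\in\mathcal{P}_2(K)$ and $n\ge 2$, let $Y_1,\dots,Y_n$ be i.i.d. column vectors in $K^2$ with Gaussian law of mean $0$ and covariance $\Sigma$ (for $K=\mathbb{C}$, the circularly symmetric complex Gaussian with $E[YY^*]=\Sigma$). $\mathcal{W}(\Sigma,n)$ is the law of $\sum_{i=1}^n Y_iY_i^*$, which lies in $\mathcal{P}_2(K)$ almost surely. Projective Wishart distribution: let $\mathcal{S}=\{X\in\mathcal{P}_2(K):\det(X)=1\}$ and let $\pi:\mathcal{P}_2(K)\to\mathcal{S}$, $\pi(X)=\det(X)^{-1/2}X$. $P\mathcal{W}(\Sigma,n)$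 is the law on $\mathcal{S}$ of $\pi(X)$ when $X\sim\mathcal{W}(\Sigma,n)$. Affine-invariant distance on $\mathcal{S}$: $\operatorname{dist}(x,y)=c\,\|\log(x^{-1/2}yx^{-1/2})\|$, with $\|\cdot\|$ the Frobenius norm, $\log$ the matrix logarithm, and $c>0$ a fixed constant (the distance is defined up to this multiplicative constant). Density: $SL_2(K)$ acts on $\mathcal{S}$ by $G\cdot x=GxG^*$. Up to a multiplicative factor there is a unique volume measure on $\mathcal{S}$ invariant under this action; fix such a measure $\nu$. $f_{P\mathcal{W}}(\cdot;\Sigma,n):\mathcal{S}\to\mathbb{R}$ is the density of $P\mathcal{W}(\Sigma,n)$ with respect to $\nu$, i.e. $P\mathcal{W}(\Sigma,n)(A)=\int_A f_{P\mathcal{W}}(x;\Sigma,n)\,\mathrm{d}\nu(x)$ for every measurable $A\subset\mathcal{S}$, chosen to be continuous. *)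

theory Defs
  imports "HOL-Probability.Probability" "Jordan_Normal_Form.Conjugate"
begin

text \<open>
  The definitions are polymorphic in the scalar type and are meant for the two types \<^typ>\<open>real\<close>
  and \<^typ>\<open>complex\<close>. There \<^const>\<open>conjugate\<close> is the identity and complex conjugation
  respectively, and \<open>0 < z\<close> on complex numbers means that \<open>z\<close> is real and positive.
\<close>

definition ctranspose :: "'k::conjugate^'n^'m \<Rightarrow> 'k^'m^'n" where
  "ctranspose A = (\<chi> i j. conjugate (A $ j $ i))"

definition PD2 :: "'k::conjugatable_ordered_field^2^2 \<Rightarrow> bool" where
  "PD2 A \<longleftrightarrow> ctranspose A = A \<and>
     (\<forall>v. v \<noteq> 0 \<longrightarrow> 0 < (\<Sum>i\<in>UNIV. conjugate (v $ i) * (A *v v) $ i))"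

definition P2 :: "('k::conjugatable_ordered_field^2^2) set" where
  "P2 = {A. PD2 A}"

definition S2 :: "('k::conjugatable_ordered_field^2^2) set" where
  "S2 = {X \<in> P2. det X = 1}"

text \<open>On \<open>P2\<close> the determinant is a positive real scalar, so its norm is the determinant itself,
  read as a real number.\<close>

definition proj_S2 :: "'k::real_normed_field^2^2 \<Rightarrow> 'k^2^2" where
  "proj_S2 X = (norm (det X) powr (- 1 / 2)) *\<^sub>R X"


subsection \<open>Wishart laws\<close>

text \<open>
  With \<open>\<beta> = DIM('k)\<close>, i.e. \<open>\<beta> = 1\<close> for the reals and \<open>\<beta> = 2\<close> for the complex numbers, the density
  of the centred (circularly symmetric) Gaussian law on \<open>K\<^sup>d\<close> with covariance \<open>E[Y Y\<^sup>*] = \<Sigma>\<close> is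
  \<open>(\<beta> / 2\<pi>)\<close> to the power \<open>d\<beta> / 2\<close>, times \<open>det \<Sigma>\<close> to the power \<open>- \<beta> / 2\<close>, times
  \<open>exp (- (\<beta> / 2) y\<^sup>* \<Sigma>\<^sup>-\<^sup>1 y)\<close>. Here \<open>d = 2\<close>. The real inner product below is the real part of
  \<open>y\<^sup>* \<Sigma>\<^sup>-\<^sup>1 y\<close>, a quantity that is real already.
\<close>

definition gaussian_law ::
  "'k::{real_normed_field, euclidean_space}^2^2 \<Rightarrow> ('k^2) measure" where
  "gaussian_law \<Sigma> = density lborel (\<lambda>y. ennreal (
     (DIM('k) / (2 * pi)) ^ DIM('k) * norm (det \<Sigma>) powr (- real DIM('k) / 2) *
     exp (- (real DIM('k) / 2) * (y \<bullet> (matrix_inv \<Sigma> *v y)))))"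

lemma gaussian_law_real:
  fixes \<Sigma> :: "real^2^2"
  assumes "det \<Sigma> > 0"
  shows "gaussian_law \<Sigma> = density lborel (\<lambda>y.
    ennreal (exp (- (y \<bullet> (matrix_inv \<Sigma> *v y)) / 2) / (2 * pi * sqrt (det \<Sigma>))))"
  using assms
  by (simp add: gaussian_law_def powr_minus powr_half_sqrt field_simps)

lemma gaussian_law_complex:
  fixes \<Sigma> :: "complex^2^2"
  assumes "det \<Sigma> = of_real \<delta>" "\<delta> > 0"
  shows "gaussian_law \<Sigma> = density lborel (\<lambda>y.
    ennreal (exp (- Re (\<Sum>i\<in>UNIV. cnj (y $ i) * (matrix_inv \<Sigma> *v y) $ i)) / (pi\<^sup>2 * \<delta>)))"
proof -
  have "y \<bullet> (matrix_inv \<Sigma> *v y) = Re (\<Sum>i\<in>UNIV. cnj (y $ i) * (matrix_inv \<Sigma> *v y) $ i)"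
    for y :: "complex^2"
    by (simp add: inner_vec_def inner_complex_def)
  with assms show ?thesis
    by (simp add: gaussian_law_def powr_minus power_divide field_simps)
qed

definition outer :: "'k::{conjugate, times}^2 \<Rightarrow> 'k^2^2" where
  "outer y = (\<chi> i j. y $ i * conjugate (y $ j))"

definition wishart ::
  "'k::{conjugate, real_normed_field, euclidean_space}^2^2 \<Rightarrow> nat \<Rightarrow> ('k^2^2) measure" where
  "wishart \<Sigma> n = distr (\<Pi>\<^sub>M i\<in>{1..n}. gaussian_law \<Sigma>) borel (\<lambda>Y. \<Sum>i\<in>{1..n}. outer (Y i))"

text \<open>The Wishart law is carried by \<open>P2\<close> for \<open>n \<ge> 2\<close>; restricting it to \<open>P2\<close> makes \<^const>\<open>proj_S2\<close>
  a map into \<^const>\<open>S2\<close>.\<close>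

definition proj_wishart ::
  "'k::{conjugatable_ordered_field, real_normed_field, euclidean_space}^2^2
     \<Rightarrow> nat \<Rightarrow> ('k^2^2) measure" where
  "proj_wishart \<Sigma> n =
     distr (restrict_space (wishart \<Sigma> n) P2) (restrict_space borel S2) proj_S2"


subsection \<open>Affine-invariant distance\<close>

definition mat_exp :: "'k::real_normed_field^2^2 \<Rightarrow> 'k^2^2" where
  "mat_exp A = (\<Sum>k. (1 / fact k) *\<^sub>R (((**) A ^^ k) (mat 1)))"

definition mat_log ::
  "'k::{conjugatable_ordered_field, real_normed_field}^2^2 \<Rightarrow> 'k^2^2" where
  "mat_log X = (THE L. ctranspose L = L \<and> mat_exp L = X)"

definition mat_sqrt :: "'k::conjugatable_ordered_field^2^2 \<Rightarrow> 'k^2^2" where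
  "mat_sqrt X = (THE R. R \<in> P2 \<and> R ** R = X)"

text \<open>The norm of the type \<open>'k^2^2\<close> is the Frobenius norm.\<close>

lemma norm_eq_frobenius:
  fixes A :: "'k::real_normed_vector^'n^'m"
  shows "norm A = sqrt (\<Sum>i\<in>UNIV. \<Sum>j\<in>UNIV. (norm (A $ i $ j))\<^sup>2)"
  by (simp add: norm_vec_def L2_set_def sum_nonneg)

definition ai_dist ::
  "real \<Rightarrow> 'k::{conjugatable_ordered_field, real_normed_field}^2^2 \<Rightarrow> 'k^2^2 \<Rightarrow> real" where
  "ai_dist c x y =
     c * norm (mat_log (matrix_inv (mat_sqrt x) ** y ** matrix_inv (mat_sqrt x)))"


subsection \<open>Invariant volume and densities\<close>

text \<open>An invariant volume measure is a nonzero, locally finite Borel measure on \<^const>\<open>S2\<close> that is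
  invariant under the action \<open>G \<cdot> x = G x G\<^sup>*\<close> of \<open>SL\<^sub>2(K)\<close>. Invariance alone would also admit the
  zero measure and the counting measure.\<close>

definition invariant_volume ::
  "('k::{conjugatable_ordered_field, real_normed_field}^2^2) measure \<Rightarrow> bool" where
  "invariant_volume \<nu> \<longleftrightarrow>
     space \<nu> = S2 \<and> sets \<nu> = sets (restrict_space borel S2) \<and>
     emeasure \<nu> S2 \<noteq> 0 \<and>
     (\<forall>C. compact C \<and> C \<subseteq> S2 \<longrightarrow> emeasure \<nu> C < \<infinity>) \<and>
     (\<forall>G. det G = 1 \<longrightarrow>
        (\<forall>A\<in>sets \<nu>. emeasure \<nu> ((\<lambda>x. G ** x ** ctranspose G) ` A) = emeasure \<nu> A))"

definition pw_density ::
  "('k::{conjugatable_ordered_field, real_normed_field, euclidean_space}^2^2) measure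
     \<Rightarrow> 'k^2^2 \<Rightarrow> nat \<Rightarrow> ('k^2^2 \<Rightarrow> real) \<Rightarrow> bool" where
  "pw_density \<nu> \<Sigma> n f \<longleftrightarrow>
     continuous_on S2 f \<and> integrable \<nu> f \<and>
     (\<forall>A\<in>sets \<nu>. measure (proj_wishart \<Sigma> n) A = (LINT x:A|\<nu>. f x))"

end

theory Submission
  imports Defs
begin

text \<open>
  The stabilizer of \<open>\<Sigma>\<close> in \<open>SL\<^sub>2(K)\<close> preserves the Gaussian law of covariance \<open>\<Sigma>\<close>, hence the
  Wishart and the projective Wishart law; since \<open>\<nu>\<close> is invariant as well, the continuous density is
  constant on the orbits of this stabilizer in \<open>S2\<close>. These orbits are the spheres around the
  projection of \<open>\<Sigma>\<close>: for \<open>M = x^(-1/2) \<Sigma> x^(-1/2)\<close>, which has determinant 1 and size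
  \<open>2 \<times> 2\<close>, the norm of \<open>log M\<close> determines both eigenvalues, so two points at the same distance
  give unitarily conjugate matrices, and the conjugation lifts to an element of the stabilizer.
\<close>

section \<open>Real and complex scalars\<close>

text \<open>Three obstacles shape the proof. First, \<open>invariant_volume\<close> gives invariance
  under determinant 1 only, so diagonalization, the exchange of eigenvalues and the transport of
  points all have to stay in SL_2; unitary matrices of other determinants are avoided throughout.
  Second, over the complex numbers Lebesgue measure lives on a real space of dimension 4, where its
  invariance under \<open>G\<close> would call for the real determinant of a complex matrix.
  Uniqueness of Haar measure replaces this: \<open>G\<close> preserves an ellipsoid attached to the
  covariance, and that forces the scaling factor to be 1. Third, integrals determine a density only
  almost everywhere. Continuity turns this into equality at every point once the volume is known to
  charge every nonempty open set, which transitivity of the action supplies. Size 2 is essential: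
  the eigenvalues of a point of \<open>S2\<close> have logarithms a and -a, and the norm yields the
  absolute value of a. With three logarithms of sum 0, a fixed norm would leave a whole circle of
  spectra.\<close>

class real_or_complex = conjugatable_ordered_field + real_normed_field + euclidean_space +
  \<comment> \<open>The axioms tie conjugation, norm, inner product and order to the copy of the
    reals spanned by 1. The functional \<open>inner 1\<close> plays the role of the real
    part.\<close>
  assumes conjugate_scaleR_one: "conjugate (scaleR r 1) = scaleR r 1"
    and mult_conjugate_scaleR: "x * conjugate x = scaleR (norm x * norm x) 1"
    and inner_eq_conjugate: "inner x y = inner 1 (conjugate x * y)"
    and conjugate_fixed_scaleR: "conjugate x = x \<Longrightarrow> x = scaleR (inner 1 x) 1"
    and scaleR_one_pos_iff: "0 < scaleR r 1 \<longleftrightarrow> 0 < r"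

instance real :: real_or_complex
  by intro_classes auto

instance complex :: real_or_complex
proof
  fix x y :: complex and r :: real
  show "conjugate (scaleR r 1) = (scaleR r 1 :: complex)" by simp
  show "x * conjugate x = scaleR (norm x * norm x) 1"
    using complex_norm_square[of x] by (simp add: scaleR_conv_of_real power2_eq_square)
  show "inner x y = inner 1 (conjugate x * y)"
    by (simp add: inner_complex_def)
  show "x = scaleR (inner 1 x) 1" if "conjugate x = x"
    using that by (auto simp: complex_eq_iff inner_complex_def)
  show "0 < (scaleR r 1 :: complex) \<longleftrightarrow> 0 < r"
    by (simp add: less_complex_def)
qed

lemma conjugate_of_real [simp]: "conjugate (of_real r) = (of_real r :: 'k::real_or_complex)"
  by (simp add: of_real_def conjugate_scaleR_one)

lemma mult_conjugate: "x * conjugate x = (of_real ((norm x)\<^sup>2) :: 'k::real_or_complex)"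
  by (simp only: of_real_def mult_conjugate_scaleR power2_eq_square)

lemma conjugate_fixed_real: "conjugate x = x \<Longrightarrow> x = of_real (1 \<bullet> x)" for x :: "'k::real_or_complex"
  by (simp add: of_real_def conjugate_fixed_scaleR[symmetric])

lemma of_real_pos_iff [simp]: "0 < (of_real r :: 'k::real_or_complex) \<longleftrightarrow> 0 < r"
  by (simp add: of_real_def scaleR_one_pos_iff)

lemma inner_one_of_real [simp]:
  "1 \<bullet> (of_real r :: 'k::real_or_complex) = r"
proof -
  have "1 \<bullet> (1 :: 'k) = 1"
    by (simp add: dot_square_norm)
  then show ?thesis
    by (simp add: of_real_def)
qed

lemma conjugate_scaleR [simp]:
  "conjugate (r *\<^sub>R x) = r *\<^sub>R conjugate (x :: 'k::real_or_complex)"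
  by (simp add: scaleR_conv_of_real conjugate_dist_mul)

lemma conjugate_one [simp]: "conjugate (1 :: 'k::real_or_complex) = 1"
  using conjugate_of_real[of 1] by simp

lemma norm_conjugate [simp]: "norm (conjugate x) = norm (x :: 'k::real_or_complex)"
proof (cases "x = 0")
  case False
  have "norm x * norm (conjugate x) = (norm x)\<^sup>2"
    using arg_cong[OF mult_conjugate[of x], of norm] by (simp add: norm_mult norm_power)
  with False show ?thesis
    by (simp add: power2_eq_square)
qed simp

lemma bounded_linear_conjugate: "bounded_linear (conjugate :: 'k::real_or_complex \<Rightarrow> 'k)"
  by (rule bounded_linear_intro[where K = 1]) (auto simp: conjugate_dist_add)

section \<open>Conjugate transpose, congruence and inverses\<close>

lemma ctranspose_nth [simp]: "ctranspose A $ i $ j = conjugate (A $ j $ i)"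
  by (simp add: ctranspose_def)

lemma ctranspose_ctranspose [simp]: "ctranspose (ctranspose A) = A"
  by (simp add: vec_eq_iff)

lemma ctranspose_mult:
  fixes A :: "'k::real_or_complex^'n^'m" and B :: "'k^'p^'n"
  shows "ctranspose (A ** B) = ctranspose B ** ctranspose A"
  by (simp add: vec_eq_iff matrix_matrix_mult_def sum_conjugate conjugate_dist_mul mult.commute)

lemma ctranspose_mat_1 [simp]: "ctranspose (mat 1 :: 'k::real_or_complex^'n^'n) = mat 1"
  by (simp add: vec_eq_iff mat_def)

lemma det_ctranspose [simp]:
  "det (ctranspose A) = conjugate (det (A :: 'k::real_or_complex^2^2))"
proof -
  have "conjugate (x - y) = conjugate x - conjugate y" for x y :: 'k
    using conjugate_dist_add[of x "-y"] by (simp add: conjugate_neg)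
  then show ?thesis
    by (simp add: det_2 conjugate_dist_mul)
qed

text \<open>An abbreviation, so that facts about it apply directly to the action spelled out in
  \<open>invariant_volume\<close>.\<close>

abbreviation cong_act :: "'k::conjugatable_ordered_field^2^2 \<Rightarrow> 'k^2^2 \<Rightarrow> 'k^2^2" where
  "cong_act G X \<equiv> G ** X ** ctranspose G"

lemma cong_act_cong_act:
  fixes G H X :: "'k::real_or_complex^2^2"
  shows "cong_act G (cong_act H X) = cong_act (G ** H) X"
  by (simp add: ctranspose_mult matrix_mul_assoc)

lemma ctranspose_cong_act:
  fixes G X :: "'k::real_or_complex^2^2"
  shows "ctranspose (cong_act G X) = cong_act G (ctranspose X)"
  by (simp add: ctranspose_mult matrix_mul_assoc)

lemma det_cong_act:
  fixes G X :: "'k::real_or_complex^2^2"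
  shows "det (cong_act G X) = of_real ((norm (det G))\<^sup>2) * det X"
proof -
  have "det (cong_act G X) = (det G * conjugate (det G)) * det X"
    by (simp add: det_mul mult_ac)
  then show ?thesis
    by (simp only: mult_conjugate)
qed

lemma matrix_mul_scaleR:
  fixes A B :: "'k::real_or_complex^2^2"
  shows "A ** (r *\<^sub>R B) = r *\<^sub>R (A ** B)" "(r *\<^sub>R A) ** B = r *\<^sub>R (A ** B)"
  by (simp_all add: vec_eq_iff matrix_matrix_mult_def scaleR_sum_right)

lemma matrix_inv_mult:
  fixes A :: "'k::real_or_complex^2^2"
  assumes "det A \<noteq> 0"
  shows "A ** matrix_inv A = mat 1" "matrix_inv A ** A = mat 1"
proof -
  from assms have "invertible A"
    by (simp add: invertible_det_nz)
  then have "\<exists>A'. A ** A' = mat 1 \<and> A' ** A = mat 1"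
    by (simp add: invertible_def)
  from someI_ex[OF this] show "A ** matrix_inv A = mat 1" "matrix_inv A ** A = mat 1"
    by (simp_all add: matrix_inv_def)
qed

lemma matrix_inv_unique:
  fixes A B :: "'k::real_or_complex^2^2"
  assumes "A ** B = mat 1"
  shows "matrix_inv A = B"
proof -
  have "det A * det B = 1"
    using arg_cong[OF assms, of det] by (simp add: det_mul)
  then have "det A \<noteq> 0" by auto
  then have "matrix_inv A = matrix_inv A ** (A ** B)"
    by (simp add: assms)
  also have "\<dots> = B"
    by (simp add: matrix_mul_assoc matrix_inv_mult \<open>det A \<noteq> 0\<close>)
  finally show ?thesis .
qed

lemma det_matrix_inv:
  fixes A :: "'k::real_or_complex^2^2"
  assumes "det A \<noteq> 0"
  shows "det (matrix_inv A) = inverse (det A)"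
  using arg_cong[OF matrix_inv_mult(1)[OF assms], of det] assms
  by (simp add: det_mul field_simps)

lemma ctranspose_matrix_inv:
  fixes A :: "'k::real_or_complex^2^2"
  assumes "det A \<noteq> 0"
  shows "ctranspose (matrix_inv A) = matrix_inv (ctranspose A)"
proof -
  have "ctranspose A ** ctranspose (matrix_inv A) = mat 1"
    using arg_cong[OF matrix_inv_mult(2)[OF assms], of ctranspose] by (simp add: ctranspose_mult)
  then show ?thesis
    by (rule matrix_inv_unique[symmetric])
qed

lemma right_inverse_is_left_inverse:
  fixes A B :: "'k::real_or_complex^2^2"
  assumes "A ** B = mat 1"
  shows "B ** A = mat 1"
  using assms matrix_left_right_inverse by blast

section \<open>Spectral theorem in size two\<close>

text \<open>The entries are real parameters cast into the scalar field, so that exp, ln and sqrt act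
  on eigenvalues as real functions for both scalar types.\<close>

definition diag2 :: "real \<Rightarrow> real \<Rightarrow> 'k::real_or_complex^2^2" where
  "diag2 a b = (\<chi> i j. if i = j then of_real (if i = 1 then a else b) else 0)"

lemma diag2_nth [simp]:
  "diag2 a b $ 1 $ 1 = of_real a" "diag2 a b $ 2 $ 2 = of_real b"
  "diag2 a b $ 1 $ 2 = 0" "diag2 a b $ 2 $ 1 = 0"
  by (simp_all add: diag2_def)

lemmas mat2_simps = vec_eq_iff forall_2 matrix_matrix_mult_def matrix_vector_mult_def sum_2

lemma diag2_mult: "diag2 a b ** diag2 c d = (diag2 (a * c) (b * d) :: 'k::real_or_complex^2^2)"
  by (simp add: mat2_simps)

lemma ctranspose_diag2 [simp]: "ctranspose (diag2 a b) = diag2 a b"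
  by (simp add: mat2_simps)

lemma diag2_1 [simp]: "diag2 1 1 = mat 1"
  by (simp add: mat2_simps mat_def)

lemma det_diag2: "det (diag2 a b) = of_real (a * b)"
  by (simp add: det_2)

lemma det_minus_mat: "det (A - mat x) = (A $ 1 $ 1 - x) * (A $ 2 $ 2 - x) - A $ 1 $ 2 * A $ 2 $ 1"
  for A :: "'k::real_or_complex^2^2"
  by (simp add: det_2 mat_def)

text \<open>SO(2) over the reals and SU(2) over the complex numbers.\<close>

definition su2 :: "'k::real_or_complex^2^2 \<Rightarrow> bool" where
  "su2 U \<longleftrightarrow> det U = 1 \<and> U ** ctranspose U = mat 1"

lemma su2_left: "su2 U \<Longrightarrow> ctranspose U ** U = mat 1"
  by (simp add: su2_def right_inverse_is_left_inverse)

lemma su2_ctranspose: "su2 U \<Longrightarrow> su2 (ctranspose U)"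
  using su2_left[of U] by (simp add: su2_def)

lemma su2_mult: "su2 U \<Longrightarrow> su2 V \<Longrightarrow> su2 (U ** V)"
  using cong_act_cong_act[of U V "mat 1"] by (simp add: su2_def det_mul)

lemma su2_cancel:
  assumes "su2 U"
  shows "cong_act U (cong_act (ctranspose U) X) = X" "cong_act (ctranspose U) (cong_act U X) = X"
proof -
  have "cong_act (mat 1) X = X" by simp
  with assms show "cong_act U (cong_act (ctranspose U) X) = X"
    by (simp only: cong_act_cong_act su2_def)
  have "cong_act (mat 1) X = X" by simp
  with su2_left[OF assms] show "cong_act (ctranspose U) (cong_act U X) = X"
    by (simp only: cong_act_cong_act)
qed

lemma su2_of_unit_vector:
  fixes u :: "'k::real_or_complex^2"
  assumes "norm u = 1"
  obtains U where "su2 U" "\<And>i. U $ i $ 1 = u $ i"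
proof -
  \<comment> \<open>The second column is orthogonal to \<open>u\<close> and scaled so that the
    determinant becomes the squared norm of \<open>u\<close>, which is 1.\<close>
  define U :: "'k^2^2" where "U = (\<chi> i j. if j = 1 then u $ i
    else if i = 1 then - conjugate (u $ 2) else conjugate (u $ 1))"
  have "(norm (u $ 1))\<^sup>2 + (norm (u $ 2))\<^sup>2 = 1"
    using assms by (simp add: norm_vec_def L2_set_def sum_2)
  then have "of_real ((norm (u $ 1))\<^sup>2) + of_real ((norm (u $ 2))\<^sup>2) = (1 :: 'k)"
    by (metis of_real_1 of_real_add)
  then have *: "u $ 1 * conjugate (u $ 1) + u $ 2 * conjugate (u $ 2) = 1"
    by (simp only: mult_conjugate)
  have "su2 U"
    using * by (simp add: su2_def det_2 U_def mat2_simps mat_def conjugate_neg algebra_simps)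
  moreover have "U $ i $ 1 = u $ i" for i
    by (simp add: U_def)
  ultimately show ?thesis using that by blast
qed

lemma hermitian_diag_real:
  assumes "ctranspose A = (A :: 'k::real_or_complex^2^2)"
  shows "A $ i $ i = of_real (1 \<bullet> A $ i $ i)"
proof (rule conjugate_fixed_real)
  show "conjugate (A $ i $ i) = A $ i $ i"
    using arg_cong[OF assms, of "\<lambda>B. B $ i $ i"] by simp
qed

lemma hermitian_offdiag:
  assumes "ctranspose A = (A :: 'k::real_or_complex^2^2)"
  shows "A $ i $ j = conjugate (A $ j $ i)"
  using arg_cong[OF assms, of "\<lambda>B. B $ i $ j"] by simp

text \<open>A unit eigenvector for an explicit real root of the characteristic polynomial becomes
  the first column of \<open>U\<close>. In the new basis the matrix is upper triangular, and
  Hermitian symmetry makes it diagonal.\<close>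

lemma hermitian_spectral:
  fixes A :: "'k::real_or_complex^2^2"
  assumes herm: "ctranspose A = A"
  obtains U a b where "su2 U" "A = cong_act U (diag2 a b)"
proof -
  define \<alpha> \<delta> where "\<alpha> = 1 \<bullet> A $ 1 $ 1" and "\<delta> = 1 \<bullet> A $ 2 $ 2"
  \<comment> \<open>The square of \<open>r\<close> is the discriminant of the characteristic
    polynomial, a sum of squares; \<open>l\<close> is the larger root.\<close>
  define r where "r = sqrt ((\<alpha> - \<delta>)\<^sup>2 + 4 * (norm (A $ 1 $ 2))\<^sup>2)"
  define l where "l = (\<alpha> + \<delta> + r) / 2"
  have r2: "r\<^sup>2 = (\<alpha> - \<delta>)\<^sup>2 + 4 * (norm (A $ 1 $ 2))\<^sup>2"
    unfolding r_def by (simp add: add_nonneg_nonneg)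
  have "(\<alpha> - l) * (\<delta> - l) = (r\<^sup>2 - (\<alpha> - \<delta>)\<^sup>2) / 4"
    by (simp add: l_def power2_eq_square field_simps)
  then have *: "(\<alpha> - l) * (\<delta> - l) = (norm (A $ 1 $ 2))\<^sup>2"
    by (simp add: r2)
  have A11: "A $ 1 $ 1 = of_real \<alpha>" and A22: "A $ 2 $ 2 = of_real \<delta>"
    unfolding \<alpha>_def \<delta>_def by (rule hermitian_diag_real[OF herm])+
  have "det (A - mat (of_real l)) = of_real ((\<alpha> - l) * (\<delta> - l)) - A $ 1 $ 2 * conjugate (A $ 1 $ 2)"
    by (simp add: det_minus_mat A11 A22 hermitian_offdiag[OF herm, of 2 1])
  also have "\<dots> = 0"
    by (simp only: * mult_conjugate) simp
  finally have "\<not> invertible (A - mat (of_real l))"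
    by (simp add: invertible_det_nz)
  then obtain v where v: "(A - mat (of_real l)) *v v = 0" "v \<noteq> 0"
    by (metis invertible_left_inverse matrix_left_invertible_ker)
  define u where "u = (1 / norm v) *\<^sub>R v"
  have "norm u = 1"
    using v by (simp add: u_def)
  then obtain U where U: "su2 U" "\<And>i. U $ i $ 1 = u $ i"
    using su2_of_unit_vector by blast
  have "mat (of_real l) *v v = of_real l *s v"
    by (simp add: mat2_simps mat_def)
  then have "A *v v = of_real l *s v"
    using v by (simp add: matrix_vector_mult_diff_rdistrib)
  moreover have "u = of_real (1 / norm v) *s v"
    unfolding u_def vec_eq_iff vector_scaleR_component vector_smult_component
    unfolding scaleR_conv_of_real by simp
  moreover have "A *v (k *s v) = k *s (A *v v)" for k
    by (simp add: mat2_simps algebra_simps)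
  ultimately have "A *v u = of_real l *s u"
    by (simp add: mult.commute)
  then have AU: "(A ** U) $ i $ 1 = of_real l * U $ i $ 1" for i
    using U by (simp add: matrix_vector_mult_def matrix_matrix_mult_def vec_eq_iff)
  define B where "B = cong_act (ctranspose U) A"
  have "B = ctranspose U ** (A ** U)"
    by (simp add: B_def matrix_mul_assoc)
  then have "B $ i $ 1 = of_real l * (ctranspose U ** U) $ i $ 1" for i
    by (simp add: AU matrix_matrix_mult_def[of "ctranspose U"] sum_distrib_left mult_ac)
  then have B1: "B $ 1 $ 1 = of_real l" "B $ 2 $ 1 = 0"
    using su2_left[OF U(1)] by (simp_all add: mat_def)
  have Bh: "ctranspose B = B"
    unfolding B_def by (subst ctranspose_cong_act) (simp add: herm)
  have "B $ 1 $ 2 = 0"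
    using B1 hermitian_offdiag[OF Bh, of 1 2] by simp
  moreover obtain b where "B $ 2 $ 2 = of_real b"
    using hermitian_diag_real[OF Bh] by blast
  ultimately have "B = diag2 l b"
    using B1 by (simp add: vec_eq_iff forall_2)
  moreover have "A = cong_act U B"
    using su2_cancel(1)[OF U(1), of A] by (simp only: B_def)
  ultimately have "A = cong_act U (diag2 l b)"
    by (simp only:)
  then show ?thesis
    by (rule that[OF U(1)])
qed

text \<open>The transition matrix \<open>W\<close> between two eigenbases satisfies
  \<open>W\<^sub>i\<^sub>j (g b\<^sub>j - g a\<^sub>i) = 0\<close>, which for injective \<open>g\<close> gives \<open>W\<^sub>i\<^sub>j (b\<^sub>j - a\<^sub>i) = 0\<close>.\<close>

lemma spectral_calculus_inj:
  fixes U V :: "'k::real_or_complex^2^2"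
  assumes "su2 U" "su2 V"
    and eq: "cong_act U (diag2 (g a\<^sub>1) (g a\<^sub>2)) = cong_act V (diag2 (g b\<^sub>1) (g b\<^sub>2))"
    and inj: "inj_on g {a\<^sub>1, a\<^sub>2, b\<^sub>1, b\<^sub>2}"
  shows "cong_act U (diag2 a\<^sub>1 a\<^sub>2) = cong_act V (diag2 b\<^sub>1 b\<^sub>2)"
proof -
  define W where "W = ctranspose U ** V"
  have conj_iff: "cong_act U (diag2 s\<^sub>1 s\<^sub>2) = cong_act V (diag2 t\<^sub>1 t\<^sub>2) \<longleftrightarrow>
      diag2 s\<^sub>1 s\<^sub>2 ** W = W ** diag2 t\<^sub>1 t\<^sub>2" (is "?L \<longleftrightarrow> ?R") for s\<^sub>1 s\<^sub>2 t\<^sub>1 t\<^sub>2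
  proof
    assume ?L
    then have "ctranspose U ** cong_act U (diag2 s\<^sub>1 s\<^sub>2) ** V = ctranspose U ** cong_act V (diag2 t\<^sub>1 t\<^sub>2) ** V"
      by simp
    then have "(ctranspose U ** U) ** diag2 s\<^sub>1 s\<^sub>2 ** W = W ** diag2 t\<^sub>1 t\<^sub>2 ** (ctranspose V ** V)"
      by (simp only: W_def matrix_mul_assoc)
    then show ?R
      by (simp only: su2_left[OF assms(1)] su2_left[OF assms(2)] matrix_mul_lid matrix_mul_rid)
  next
    assume ?R
    then have "U ** (diag2 s\<^sub>1 s\<^sub>2 ** W) ** ctranspose V = U ** (W ** diag2 t\<^sub>1 t\<^sub>2) ** ctranspose V"
      by simp
    then have "U ** diag2 s\<^sub>1 s\<^sub>2 ** ctranspose U ** (V ** ctranspose V) =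
        (U ** ctranspose U) ** V ** diag2 t\<^sub>1 t\<^sub>2 ** ctranspose V"
      by (simp only: W_def matrix_mul_assoc)
    then show ?L
      using assms by (simp only: su2_def matrix_mul_lid matrix_mul_rid)
  qed
  from eq have "diag2 (g a\<^sub>1) (g a\<^sub>2) ** W = W ** diag2 (g b\<^sub>1) (g b\<^sub>2)"
    by (simp only: conj_iff)
  then have "diag2 a\<^sub>1 a\<^sub>2 ** W = W ** diag2 b\<^sub>1 b\<^sub>2"
    by (auto simp: mat2_simps inj_on_eq_iff[OF inj])
  then show ?thesis
    by (simp only: conj_iff)
qed

section \<open>Positive definite matrices\<close>

lemma quadratic_form_cong_act:
  fixes G X :: "'k::real_or_complex^2^2"
  shows "(\<Sum>i\<in>UNIV. conjugate (v $ i) * (cong_act G X *v v) $ i) =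
    (\<Sum>i\<in>UNIV. conjugate ((ctranspose G *v v) $ i) * (X *v (ctranspose G *v v)) $ i)"
  by (simp add: mat2_simps conjugate_dist_mul conjugate_dist_add algebra_simps)

lemma P2_cong_act:
  fixes G X :: "'k::real_or_complex^2^2"
  assumes G: "det G \<noteq> 0" and X: "X \<in> P2"
  shows "cong_act G X \<in> P2"
proof -
  have "ctranspose G *v v \<noteq> 0" if "v \<noteq> 0" for v
  proof
    assume "ctranspose G *v v = 0"
    then have "(matrix_inv (ctranspose G) ** ctranspose G) *v v = 0"
      by (simp add: matrix_vector_mul_assoc[symmetric])
    with G that show False
      by (simp add: matrix_inv_mult)
  qed
  with X show ?thesis
    by (simp add: P2_def PD2_def quadratic_form_cong_act ctranspose_cong_act)
qed

lemma P2_cong_act_iff: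
  fixes G X :: "'k::real_or_complex^2^2"
  assumes "det G \<noteq> 0"
  shows "cong_act G X \<in> P2 \<longleftrightarrow> X \<in> P2"
proof
  assume "cong_act G X \<in> P2"
  moreover have "det (matrix_inv G) \<noteq> 0"
    using assms by (simp add: det_matrix_inv)
  ultimately have "cong_act (matrix_inv G) (cong_act G X) \<in> P2"
    by (rule P2_cong_act[rotated])
  moreover have "cong_act (matrix_inv G) (cong_act G X) = cong_act (mat 1) X"
    by (simp only: cong_act_cong_act matrix_inv_mult[OF assms])
  ultimately show "X \<in> P2" by simp
qed (rule P2_cong_act[OF assms])

lemma S2_cong_act_iff:
  fixes G X :: "'k::real_or_complex^2^2"
  assumes "det G = 1"
  shows "cong_act G X \<in> S2 \<longleftrightarrow> X \<in> S2"
  using assms by (simp add: S2_def P2_cong_act_iff det_cong_act)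

lemma P2_diag2_iff: "(diag2 a b :: 'k::real_or_complex^2^2) \<in> P2 \<longleftrightarrow> 0 < a \<and> 0 < b"
proof -
  have form: "(\<Sum>i\<in>UNIV. conjugate (v $ i) * (diag2 a b *v v) $ i) =
      of_real (a * (norm (v $ 1))\<^sup>2 + b * (norm (v $ 2))\<^sup>2)" for v :: "'k^2"
  proof -
    have "(\<Sum>i\<in>UNIV. conjugate (v $ i) * (diag2 a b *v v) $ i) =
        of_real a * (v $ 1 * conjugate (v $ 1)) + of_real b * (v $ 2 * conjugate (v $ 2))"
      by (simp add: mat2_simps mult_ac)
    then show ?thesis
      by (simp only: mult_conjugate of_real_add of_real_mult)
  qed
  have pd: "(diag2 a b :: 'k^2^2) \<in> P2 \<longleftrightarrow>
      (\<forall>v :: 'k^2. v \<noteq> 0 \<longrightarrow> 0 < a * (norm (v $ 1))\<^sup>2 + b * (norm (v $ 2))\<^sup>2)"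
    unfolding P2_def PD2_def mem_Collect_eq
    by (subst form, subst of_real_pos_iff, simp)
  show ?thesis
  proof
    assume *: "(diag2 a b :: 'k^2^2) \<in> P2"
    have "axis 1 1 \<noteq> (0 :: 'k^2)" "axis 2 1 \<noteq> (0 :: 'k^2)" by (simp_all add: axis_eq_0_iff)
    with * show "0 < a \<and> 0 < b"
      using spec[of _ "axis 1 1"] spec[of _ "axis 2 1"] unfolding pd by (force simp: axis_def)
  next
    assume ab: "0 < a \<and> 0 < b"
    have "0 < a * (norm (v $ 1))\<^sup>2 + b * (norm (v $ 2))\<^sup>2" if "v \<noteq> 0" for v :: "'k^2"
      using that ab by (auto simp: vec_eq_iff forall_2 intro: add_pos_nonneg add_nonneg_pos)
    then show "(diag2 a b :: 'k^2^2) \<in> P2"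
      by (simp only: pd) simp
  qed
qed

lemma su2_det_nonzero: "su2 U \<Longrightarrow> det U \<noteq> 0"
  by (simp add: su2_def)

lemma P2_spectral:
  fixes X :: "'k::real_or_complex^2^2"
  assumes "X \<in> P2"
  obtains U a b where "su2 U" "X = cong_act U (diag2 a b)" "0 < a" "0 < b"
proof -
  have "ctranspose X = X"
    using assms by (simp add: P2_def PD2_def)
  then obtain U a b where U: "su2 U" "X = cong_act U (diag2 a b)"
    by (rule hermitian_spectral)
  then have "diag2 a b \<in> (P2 :: ('k^2^2) set)"
    using assms P2_cong_act_iff[OF su2_det_nonzero] by blast
  with U that show ?thesis
    by (simp add: P2_diag2_iff)
qed

section \<open>Quantities preserved by conjugation with \<open>su2\<close>\<close>

lemma trace_cong_act_su2:
  fixes X :: "'k::real_or_complex^2^2"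
  assumes "su2 U"
  shows "trace (cong_act U X) = trace X"
proof -
  have "trace (cong_act U X) = trace (ctranspose U ** U ** X)"
    by (subst trace_mul_sym) (simp add: matrix_mul_assoc)
  then show ?thesis
    by (simp add: su2_left[OF assms])
qed

lemma det_cong_act_su2:
  fixes X :: "'k::real_or_complex^2^2"
  assumes "su2 U"
  shows "det (cong_act U X) = det X"
  using assms by (simp add: det_cong_act su2_def)

text \<open>Two real numbers are positive exactly when their sum and product are. In this form
  \<open>P2\<close> is cut out by finitely many continuous conditions, whence its
  measurability.\<close>

lemma P2_iff_trace_det:
  fixes X :: "'k::real_or_complex^2^2"
  shows "X \<in> P2 \<longleftrightarrow> ctranspose X = X \<and> 0 < 1 \<bullet> trace X \<and> 0 < 1 \<bullet> det X"
proof (cases "ctranspose X = X")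
  case True
  then obtain U a b where U: "su2 U" "X = cong_act U (diag2 a b)"
    by (rule hermitian_spectral)
  have "trace X = of_real (a + b)"
    unfolding U(2) trace_cong_act_su2[OF U(1)] by (simp add: trace_def sum_2)
  moreover have "det X = of_real (a * b)"
    unfolding U(2) det_cong_act_su2[OF U(1)] by (rule det_diag2)
  moreover have "X \<in> P2 \<longleftrightarrow> 0 < a \<and> 0 < b"
    unfolding U(2) P2_cong_act_iff[OF su2_det_nonzero[OF U(1)]] by (rule P2_diag2_iff)
  moreover have "0 < a \<and> 0 < b \<longleftrightarrow> 0 < a + b \<and> 0 < a * b"
    by (auto simp: zero_less_mult_iff)
  ultimately show ?thesis
    using True by (simp only: inner_one_of_real) simp
qed (simp add: P2_def PD2_def)

lemma trace_mult_ctranspose: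
  fixes X :: "'k::real_or_complex^2^2"
  shows "trace (X ** ctranspose X) = of_real ((norm X)\<^sup>2)"
proof -
  have "trace (X ** ctranspose X) = (\<Sum>i\<in>UNIV. \<Sum>j\<in>UNIV. X $ i $ j * conjugate (X $ i $ j))"
    by (simp add: trace_def matrix_matrix_mult_def)
  also have "\<dots> = of_real (\<Sum>i\<in>UNIV. \<Sum>j\<in>UNIV. (norm (X $ i $ j))\<^sup>2)"
    by (simp only: mult_conjugate of_real_sum)
  finally show ?thesis
    by (simp add: norm_eq_frobenius sum_nonneg)
qed

text \<open>The squared Frobenius norm is the trace of \<open>X ** ctranspose X\<close>, a product
  that is itself merely conjugated by \<open>U\<close>.\<close>

lemma norm_cong_act_su2:
  fixes X :: "'k::real_or_complex^2^2"
  assumes "su2 U"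
  shows "norm (cong_act U X) = norm X"
proof -
  have "cong_act U X ** ctranspose (cong_act U X) = U ** X ** (ctranspose U ** U) ** ctranspose X ** ctranspose U"
    by (simp add: ctranspose_mult matrix_mul_assoc)
  also have "\<dots> = cong_act U (X ** ctranspose X)"
    by (simp add: su2_left[OF assms] matrix_mul_assoc)
  finally have "trace (cong_act U X ** ctranspose (cong_act U X)) = trace (X ** ctranspose X)"
    by (simp only: trace_cong_act_su2[OF assms])
  then have "(norm (cong_act U X))\<^sup>2 = (norm X)\<^sup>2"
    by (simp only: trace_mult_ctranspose of_real_eq_iff)
  then show ?thesis by simp
qed

lemma matrix_add_rdistrib:
  fixes A B C :: "'k::real_or_complex^2^2"
  shows "(A + B) ** C = A ** C + B ** C"
  by (simp add: mat2_simps algebra_simps)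

lemma norm_diag2: "norm (diag2 a b :: 'k::real_or_complex^2^2) = sqrt (a\<^sup>2 + b\<^sup>2)"
  by (simp add: norm_eq_frobenius sum_2)

section \<open>Exponential, logarithm and square root\<close>

lemma cong_act_su2_power:
  fixes X :: "'k::real_or_complex^2^2"
  assumes "su2 U"
  shows "((**) (cong_act U X) ^^ k) (mat 1) = cong_act U (((**) X ^^ k) (mat 1))"
proof (induction k)
  case 0
  then show ?case using assms by (simp add: su2_def)
next
  case (Suc k)
  have "cong_act U X ** cong_act U Y = U ** X ** (ctranspose U ** U) ** Y ** ctranspose U" for Y
    by (simp add: matrix_mul_assoc)
  with Suc show ?case
    by (simp add: su2_left[OF assms] matrix_mul_assoc)
qed

lemma diag2_power: "((**) (diag2 a b) ^^ k) (mat 1) = (diag2 (a ^ k) (b ^ k) :: 'k::real_or_complex^2^2)"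
  by (induction k) (simp_all add: diag2_mult)

lemma mat_exp_spectral:
  fixes U :: "'k::real_or_complex^2^2"
  assumes "su2 U"
  shows "mat_exp (cong_act U (diag2 a b)) = cong_act U (diag2 (exp a) (exp b))"
proof -
  \<comment> \<open>The two spectral projections: the matrix series splits into two scalar
    exponential series with these fixed coefficients.\<close>
  define P Q where "P = cong_act U (diag2 1 0)" and "Q = cong_act U (diag2 0 1)"
  have decomp: "cong_act U (diag2 s t) = s *\<^sub>R P + t *\<^sub>R Q" for s t
  proof -
    have "diag2 s t = s *\<^sub>R diag2 1 0 + t *\<^sub>R (diag2 0 1 :: 'k^2^2)"
      unfolding vec_eq_iff forall_2 vector_add_component vector_scaleR_component
      by (simp add: of_real_def)
    then show ?thesis
      by (simp only: P_def Q_def matrix_add_ldistrib matrix_add_rdistrib matrix_mul_scaleR)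
  qed
  have e: "(\<lambda>k. s ^ k / fact k) sums exp s" for s :: real
    using exp_converges[of s] by (simp add: field_simps)
  have "(\<lambda>k. (a ^ k / fact k) *\<^sub>R P + (b ^ k / fact k) *\<^sub>R Q) sums (exp a *\<^sub>R P + exp b *\<^sub>R Q)"
    by (intro sums_add sums_scaleR_left e)
  moreover have "(1 / fact k) *\<^sub>R (((**) (cong_act U (diag2 a b)) ^^ k) (mat 1)) =
      (a ^ k / fact k) *\<^sub>R P + (b ^ k / fact k) *\<^sub>R Q" for k
    unfolding cong_act_su2_power[OF assms] diag2_power unfolding decomp
    by (simp add: scaleR_add_right)
  ultimately show ?thesis
    unfolding mat_exp_def decomp by (simp add: sums_iff)
qed

text \<open>\<open>mat_log\<close> is a definite description, so uniqueness is at stake. Any other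
  candidate is Hermitian, hence diagonalizable, and injectivity of the real exponential identifies
  it.\<close>

lemma mat_log_spectral:
  fixes U :: "'k::real_or_complex^2^2"
  assumes U: "su2 U" and pos: "0 < a" "0 < b"
  shows "mat_log (cong_act U (diag2 a b)) = cong_act U (diag2 (ln a) (ln b))"
  unfolding mat_log_def
proof (rule the_equality)
  show "ctranspose (cong_act U (diag2 (ln a) (ln b))) = cong_act U (diag2 (ln a) (ln b)) \<and>
      mat_exp (cong_act U (diag2 (ln a) (ln b))) = cong_act U (diag2 a b)"
    by (simp only: ctranspose_cong_act ctranspose_diag2 mat_exp_spectral[OF U] exp_ln pos)
next
  fix L :: "'k^2^2"
  assume L: "ctranspose L = L \<and> mat_exp L = cong_act U (diag2 a b)"
  then obtain V s t where V: "su2 V" "L = cong_act V (diag2 s t)"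
    using hermitian_spectral by blast
  have "cong_act V (diag2 (exp s) (exp t)) = cong_act U (diag2 (exp (ln a)) (exp (ln b)))"
    using L by (simp only: V(2) mat_exp_spectral[OF V(1)] exp_ln pos)
  then show "L = cong_act U (diag2 (ln a) (ln b))"
    unfolding V(2) by (rule spectral_calculus_inj[OF V(1) U]) (simp add: inj_on_def)
qed

lemma cong_act_su2_square:
  fixes U :: "'k::real_or_complex^2^2"
  assumes "su2 U"
  shows "cong_act U (diag2 a b) ** cong_act U (diag2 a b) = cong_act U (diag2 (a\<^sup>2) (b\<^sup>2))"
proof -
  have "cong_act U (diag2 a b) ** cong_act U (diag2 a b) =
      U ** diag2 a b ** (ctranspose U ** U) ** diag2 a b ** ctranspose U"
    by (simp only: matrix_mul_assoc)
  also have "\<dots> = U ** (diag2 a b ** diag2 a b) ** ctranspose U"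
    by (simp only: su2_left[OF assms] matrix_mul_rid matrix_mul_assoc)
  finally show ?thesis
    by (simp only: diag2_mult power2_eq_square)
qed

text \<open>Uniqueness follows as for the logarithm, except that squaring is injective only on
  positive eigenvalues; this is where membership of the root in \<open>P2\<close> enters.\<close>

lemma mat_sqrt_spectral:
  fixes U :: "'k::real_or_complex^2^2"
  assumes U: "su2 U" and pos: "0 < a" "0 < b"
  shows "mat_sqrt (cong_act U (diag2 a b)) = cong_act U (diag2 (sqrt a) (sqrt b))"
  unfolding mat_sqrt_def
proof (rule the_equality)
  show "cong_act U (diag2 (sqrt a) (sqrt b)) \<in> P2 \<and>
      cong_act U (diag2 (sqrt a) (sqrt b)) ** cong_act U (diag2 (sqrt a) (sqrt b)) = cong_act U (diag2 a b)"
    unfolding cong_act_su2_square[OF U] P2_cong_act_iff[OF su2_det_nonzero[OF U]]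
    using pos by (simp add: P2_diag2_iff)
next
  fix R :: "'k^2^2"
  assume R: "R \<in> P2 \<and> R ** R = cong_act U (diag2 a b)"
  then obtain V s t where V: "su2 V" "R = cong_act V (diag2 s t)" "0 < s" "0 < t"
    using P2_spectral by blast
  have "(sqrt a)\<^sup>2 = a" "(sqrt b)\<^sup>2 = b"
    using pos by simp_all
  then have "cong_act V (diag2 (s\<^sup>2) (t\<^sup>2)) = cong_act U (diag2 ((sqrt a)\<^sup>2) ((sqrt b)\<^sup>2))"
    using R by (simp only: V(2) cong_act_su2_square[OF V(1)])
  then show "R = cong_act U (diag2 (sqrt a) (sqrt b))"
    unfolding V(2)
    by (rule spectral_calculus_inj[OF V(1) U])
      (use V pos in \<open>auto intro!: inj_onI simp: power2_eq_iff\<close>)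
qed

lemma mat_sqrt_P2:
  fixes X :: "'k::real_or_complex^2^2"
  assumes "X \<in> P2"
  shows "mat_sqrt X \<in> P2" "mat_sqrt X ** mat_sqrt X = X"
proof -
  obtain U a b where U: "su2 U" "X = cong_act U (diag2 a b)" and pos: "0 < a" "0 < b"
    using assms by (rule P2_spectral)
  have eq: "mat_sqrt X = cong_act U (diag2 (sqrt a) (sqrt b))"
    unfolding U(2) by (rule mat_sqrt_spectral[OF U(1) pos])
  show "mat_sqrt X \<in> P2"
    unfolding eq P2_cong_act_iff[OF su2_det_nonzero[OF U(1)]]
    using pos by (simp add: P2_diag2_iff)
  show "mat_sqrt X ** mat_sqrt X = X"
    unfolding eq cong_act_su2_square[OF U(1)] unfolding U(2) using pos by simp
qed

lemma P2_hermitian: "X \<in> P2 \<Longrightarrow> ctranspose X = X"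
  by (simp add: P2_def PD2_def)

lemma P2_det:
  fixes X :: "'k::real_or_complex^2^2"
  assumes "X \<in> P2"
  obtains d where "0 < d" "det X = of_real d"
proof -
  obtain U a b where U: "su2 U" "X = cong_act U (diag2 a b)" and pos: "0 < a" "0 < b"
    using assms by (rule P2_spectral)
  have "det X = of_real (a * b)"
    unfolding U(2) det_cong_act_su2[OF U(1)] by (rule det_diag2)
  with pos that show ?thesis by (meson mult_pos_pos)
qed

lemma P2_det_nonzero:
  fixes X :: "'k::real_or_complex^2^2"
  shows "X \<in> P2 \<Longrightarrow> det X \<noteq> 0"
  by (erule P2_det) simp

lemma mat_sqrt_S2:
  fixes X :: "'k::real_or_complex^2^2"
  assumes "X \<in> S2"
  shows "mat_sqrt X \<in> S2"
proof -
  have P: "mat_sqrt X \<in> P2" "mat_sqrt X ** mat_sqrt X = X" "det X = 1"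
    using assms mat_sqrt_P2[of X] by (auto simp: S2_def)
  from P(1) obtain d where d: "0 < d" "det (mat_sqrt X) = of_real d"
    by (rule P2_det)
  have "of_real (d * d) = (1 :: 'k)"
    using arg_cong[OF P(2), of det] P(3) d by (simp add: det_mul)
  then have "d * d = 1"
    by (metis of_real_eq_1_iff)
  then have "d = 1"
    using d by (auto simp: square_eq_1_iff)
  with P d show ?thesis by (simp add: S2_def)
qed

section \<open>Homogeneity of the space S2\<close>

text \<open>Two points of \<open>S2\<close> whose logarithms have equal norm have the same spectrum, since
  the eigenvalues of such a point are \<open>a\<close> and \<open>1 / a\<close>.\<close>

lemma S2_conjugate_if_norm_log_eq:
  fixes M N :: "'k::real_or_complex^2^2"
  assumes "M \<in> S2" "N \<in> S2" and eq: "norm (mat_log M) = norm (mat_log N)"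
  obtains U where "su2 U" "cong_act U M = N"
proof -
  have spec: "\<exists>U a. su2 U \<and> M = cong_act U (diag2 (exp a) (exp (- a))) \<and>
      norm (mat_log M) = sqrt 2 * \<bar>a\<bar>" if M: "M \<in> S2" for M :: "'k^2^2"
  proof -
    have "M \<in> P2" using M by (simp add: S2_def)
    then obtain U a b where U: "su2 U" "M = cong_act U (diag2 a b)" and pos: "0 < a" "0 < b"
      by (rule P2_spectral)
    have "det M = of_real (a * b)"
      unfolding U(2) det_cong_act_su2[OF U(1)] by (rule det_diag2)
    then have "of_real (a * b) = (1 :: 'k)"
      using M by (simp add: S2_def)
    then have "a * b = 1"
      by (metis of_real_eq_1_iff)
    then have b: "b = exp (- ln a)"
      using pos by (simp add: exp_minus field_simps)
    have "norm (mat_log M) = sqrt ((ln a)\<^sup>2 + (ln b)\<^sup>2)"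
      unfolding U(2) mat_log_spectral[OF U(1) pos] norm_cong_act_su2[OF U(1)] norm_diag2 ..
    also have "\<dots> = sqrt 2 * \<bar>ln a\<bar>"
      unfolding b by (simp add: real_sqrt_mult flip: mult_2)
    finally have n: "norm (mat_log M) = sqrt 2 * \<bar>ln a\<bar>" .
    have "M = cong_act U (diag2 (exp (ln a)) (exp (- ln a)))"
      unfolding b[symmetric] U(2) using pos by simp
    with U n show ?thesis by blast
  qed
  obtain U a where U: "su2 U" "M = cong_act U (diag2 (exp a) (exp (- a)))"
      "norm (mat_log M) = sqrt 2 * \<bar>a\<bar>"
    using spec[OF assms(1)] by blast
  obtain V b where V: "su2 V" "N = cong_act V (diag2 (exp b) (exp (- b)))"
      "norm (mat_log N) = sqrt 2 * \<bar>b\<bar>"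
    using spec[OF assms(2)] by blast
  \<comment> \<open>Equal norms leave the case b = -a, in which the two eigenvalues must trade
    places. The permutation matrix has determinant -1; this quarter turn has determinant 1.\<close>
  define J :: "'k^2^2" where "J = (\<chi> i j. if i = j then 0 else if i = 1 then 1 else - 1)"
  have J: "su2 J" "cong_act J (diag2 s t) = diag2 t s" for s t
    by (simp_all add: su2_def J_def det_2 mat2_simps mat_def conjugate_neg)
  have I: "su2 (mat 1 :: 'k^2^2)" "cong_act (mat 1) X = X" for X :: "'k^2^2"
    by (simp_all add: su2_def)
  have "\<bar>a\<bar> = \<bar>b\<bar>"
    using eq U(3) V(3) by simp
  then have "b = a \<or> b = - a" by linarith
  then obtain K where K: "su2 K" "cong_act K (diag2 (exp a) (exp (- a))) = (diag2 (exp b) (exp (- b)) :: 'k^2^2)"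
  proof
    assume "b = a"
    with I that show thesis by blast
  next
    assume "b = - a"
    with J(1) J(2)[of "exp a" "exp (- a)"] that show thesis by simp
  qed
  have "cong_act (V ** (K ** ctranspose U)) M = N"
    unfolding cong_act_cong_act[symmetric] unfolding U(2) su2_cancel(2)[OF U(1)] K(2) V(2) ..
  then show ?thesis
    using that su2_mult[OF V(1) su2_mult[OF K(1) su2_ctranspose[OF U(1)]]] by blast
qed

lemma matrix_inv_S2:
  fixes X :: "'k::real_or_complex^2^2"
  assumes "X \<in> S2"
  shows "det (matrix_inv X) = 1" "ctranspose (matrix_inv X) = matrix_inv X"
  using assms P2_hermitian[of X]
  by (simp_all add: S2_def det_matrix_inv ctranspose_matrix_inv)

text \<open>The distance whitens by its first argument: \<open>matrix_inv R\<close> moves x to the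
  identity and s to M, while \<open>matrix_inv T\<close> moves y to the identity and s to N. The
  unitary carrying M to N fixes the identity, so inserting it between the first whitening and the
  inverse of the second sends x to y and s back to s.\<close>

lemma two_point_homogeneous:
  fixes x y s :: "'k::real_or_complex^2^2"
  assumes x: "x \<in> S2" and y: "y \<in> S2" and s: "s \<in> S2" and "c \<noteq> 0"
    and eq: "ai_dist c x s = ai_dist c y s"
  obtains G where "det G = 1" "cong_act G s = s" "cong_act G x = y"
proof -
  define R T where "R = mat_sqrt x" and "T = mat_sqrt y"
  have R: "R \<in> S2" "R ** R = x" and T: "T \<in> S2" "T ** T = y"
    using x y mat_sqrt_S2 mat_sqrt_P2 by (auto simp: R_def T_def S2_def)
  have Rh: "ctranspose R = R" and Th: "ctranspose T = T"
    using R T by (auto simp: S2_def P2_hermitian)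
  have nz: "det R \<noteq> 0" "det T \<noteq> 0" "det R = 1" "det T = 1"
    using R T by (auto simp: S2_def)
  define M N where "M = cong_act (matrix_inv R) s" and "N = cong_act (matrix_inv T) s"
  have MN: "M \<in> S2" "N \<in> S2"
    unfolding M_def N_def
    using s S2_cong_act_iff[of "matrix_inv R" s] S2_cong_act_iff[of "matrix_inv T" s]
    by (simp_all only: matrix_inv_S2(1)[OF R(1)] matrix_inv_S2(1)[OF T(1)])
  have "norm (mat_log M) = norm (mat_log N)"
    using eq \<open>c \<noteq> 0\<close> by (simp add: ai_dist_def M_def N_def matrix_inv_S2 R T flip: R_def T_def)
  with MN obtain U where U: "su2 U" "cong_act U M = N"
    by (rule S2_conjugate_if_norm_log_eq)
  define G where "G = T ** (U ** matrix_inv R)"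
  have "det G = 1"
    using U nz matrix_inv_S2 R by (simp add: G_def det_mul su2_def)
  moreover have "cong_act G s = s"
  proof -
    have "cong_act G s = cong_act T (cong_act U M)"
      by (simp only: G_def M_def cong_act_cong_act)
    also have "\<dots> = cong_act T N"
      by (simp only: U(2))
    also have "\<dots> = cong_act (mat 1) s"
      by (simp only: N_def cong_act_cong_act matrix_inv_mult[OF nz(2)])
    finally show ?thesis by simp
  qed
  moreover have "cong_act G x = y"
  proof -
    have "cong_act (matrix_inv R) x = (matrix_inv R ** R) ** (R ** matrix_inv R)"
      unfolding matrix_inv_S2(2)[OF R(1)] by (simp only: R(2)[symmetric] matrix_mul_assoc)
    then have "cong_act (matrix_inv R) x = mat 1"
      by (simp only: matrix_inv_mult[OF nz(1)] matrix_mul_lid)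
    then have "cong_act G x = cong_act T (cong_act U (mat 1))"
      by (simp only: G_def cong_act_cong_act[symmetric])
    also have "\<dots> = y"
      using U(1) T Th by (simp add: su2_def)
    finally show ?thesis .
  qed
  ultimately show ?thesis by (rule that)
qed

text \<open>Each point is the image of the identity under its own square root, so the identity
  serves as a halfway stop.\<close>

lemma S2_transitive:
  fixes x y :: "'k::real_or_complex^2^2"
  assumes x: "x \<in> S2" and y: "y \<in> S2"
  obtains G where "det G = 1" "cong_act G x = y"
proof -
  define R T where "R = mat_sqrt x" and "T = mat_sqrt y"
  have R: "R \<in> S2" "R ** R = x" and T: "T \<in> S2" "T ** T = y"
    using x y mat_sqrt_S2 mat_sqrt_P2 by (auto simp: R_def T_def S2_def)
  have Rh: "ctranspose R = R" and Th: "ctranspose T = T"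
    using R T by (auto simp: S2_def P2_hermitian)
  have nz: "det R \<noteq> 0" "det T = 1"
    using R T by (auto simp: S2_def)
  have "cong_act (matrix_inv R) x = (matrix_inv R ** R) ** (R ** matrix_inv R)"
    unfolding matrix_inv_S2(2)[OF R(1)] by (simp only: R(2)[symmetric] matrix_mul_assoc)
  then have "cong_act (T ** matrix_inv R) x = cong_act T (mat 1)"
    by (simp only: matrix_inv_mult[OF nz(1)] matrix_mul_lid cong_act_cong_act[symmetric])
  then have "cong_act (T ** matrix_inv R) x = y"
    using T Th by simp
  moreover have "det (T ** matrix_inv R) = 1"
    using nz matrix_inv_S2 R by (simp add: det_mul)
  ultimately show ?thesis using that by blast
qed

section \<open>Linear maps preserving Lebesgue measure\<close>

lemma nn_integral_lborel_add:
  fixes f :: "'a::euclidean_space \<Rightarrow> ennreal"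
  assumes [measurable]: "f \<in> borel_measurable borel"
  shows "(\<integral>\<^sup>+x. f (c + x) \<partial>lborel) = (\<integral>\<^sup>+x. f x \<partial>lborel)"
proof -
  have "(\<integral>\<^sup>+x. f x \<partial>lborel) = (\<integral>\<^sup>+x. f x \<partial>distr lborel borel ((+) c))"
    by (simp add: lborel_distr_plus)
  also have "\<dots> = (\<integral>\<^sup>+x. f (c + x) \<partial>lborel)"
    by (simp add: nn_integral_distr)
  finally show ?thesis ..
qed

text \<open>Uniqueness of Haar measure, with the constant fixed by the set \<open>E\<close>: both orders of
  integration of \<open>indicator E x * indicator B (x + T y)\<close> are evaluated by translation invariance.\<close>

lemma lborel_distr_linear:
  fixes T T' :: "'a::euclidean_space \<Rightarrow> 'a"
  assumes T: "linear T" and T': "\<And>x. T (T' x) = x"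
    and E: "open E" "bounded E" "0 \<in> E" "\<And>x. - x \<in> E \<longleftrightarrow> x \<in> E" "\<And>x. T x \<in> E \<longleftrightarrow> x \<in> E"
  shows "distr lborel borel T = lborel"
proof (rule measure_eqI)
  fix B assume "B \<in> sets (distr lborel borel T)"
  then have [measurable]: "B \<in> sets borel" by simp
  have [measurable]: "E \<in> sets borel" using E by simp
  have "continuous_on UNIV T"
    using T by (simp add: linear_continuous_on linear_conv_bounded_linear)
  then have [measurable]: "T \<in> borel_measurable borel"
    by (rule borel_measurable_continuous_onI)
  obtain e where e: "e > 0" "ball 0 e \<subseteq> E"
    using E openE by blast
  have "emeasure lborel (ball (0::'a) e) \<noteq> 0"
    using content_ball_pos[OF e(1), of "0::'a"] by (auto simp: measure_def)
  then have E_pos: "emeasure lborel E \<noteq> 0"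
    using e(2) emeasure_mono[of "ball 0 e" E lborel] by auto
  have E_fin: "emeasure lborel E \<noteq> \<infinity>"
    using emeasure_bounded_finite[OF E(2)] by auto
  let ?I = "\<integral>\<^sup>+y. \<integral>\<^sup>+x. indicator E x * indicator B (x + T y) \<partial>lborel \<partial>lborel"
  have "?I = (\<integral>\<^sup>+y. \<integral>\<^sup>+x. indicator E (x - T y) * indicator B x \<partial>lborel \<partial>lborel)"
  proof (rule nn_integral_cong)
    fix y
    show "(\<integral>\<^sup>+x. indicator E x * indicator B (x + T y) \<partial>lborel) =
        (\<integral>\<^sup>+x. indicator E (x - T y) * indicator B x \<partial>lborel)"
      using nn_integral_lborel_add[of "\<lambda>x. indicator E (x - T y) * indicator B x" "T y"]
      by (simp add: add.commute)
  qed
  also have "\<dots> = (\<integral>\<^sup>+x. \<integral>\<^sup>+y. indicator E (x - T y) * indicator B x \<partial>lborel \<partial>lborel)"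
    by (rule lborel_pair.Fubini') measurable
  also have "\<dots> = (\<integral>\<^sup>+x. emeasure lborel E * indicator B x \<partial>lborel)"
  proof (rule nn_integral_cong)
    fix x
    \<comment> \<open>Invariance of \<open>E\<close> under \<open>T\<close> removes
      \<open>T\<close>, and symmetry removes the sign; what remains is membership of a translate of
      y in \<open>E\<close>.\<close>
    have "x - T y \<in> E \<longleftrightarrow> - T' x + y \<in> E" for y
    proof -
      have "x - T y = T (- (- T' x + y))"
        using T T' by (simp add: linear_diff linear_add linear_neg)
      then show ?thesis
        using E(4)[of "T' x - y"] by (simp add: E(5))
    qed
    then have "indicator E (x - T y) = (indicator E (- T' x + y) :: ennreal)" for y
      by (simp add: indicator_def)
    then show "(\<integral>\<^sup>+y. indicator E (x - T y) * indicator B x \<partial>lborel) = emeasure lborel E * indicator B x"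
      using nn_integral_lborel_add[of "indicator E" "- T' x"] by (simp add: nn_integral_multc)
  qed
  also have "\<dots> = emeasure lborel E * emeasure lborel B"
    by (simp add: nn_integral_cmult)
  finally have 1: "?I = emeasure lborel E * emeasure lborel B" .
  have "?I = (\<integral>\<^sup>+x. \<integral>\<^sup>+y. indicator E x * indicator B (x + T y) \<partial>lborel \<partial>lborel)"
    by (rule lborel_pair.Fubini') measurable
  also have "\<dots> = (\<integral>\<^sup>+x. indicator E x * emeasure (distr lborel borel T) B \<partial>lborel)"
  proof (rule nn_integral_cong)
    fix x
    have "x + T y = T (T' x + y)" for y
      using T T' by (simp add: linear_add)
    then have "(\<integral>\<^sup>+y. indicator B (x + T y) \<partial>lborel) = (\<integral>\<^sup>+y. indicator B (T (T' x + y)) \<partial>lborel)"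
      by simp
    also have "\<dots> = (\<integral>\<^sup>+y. indicator B (T y) \<partial>lborel)"
      by (rule nn_integral_lborel_add) measurable
    also have "\<dots> = (\<integral>\<^sup>+y. indicator B y \<partial>distr lborel borel T)"
      by (rule nn_integral_distr[symmetric]) measurable
    also have "\<dots> = emeasure (distr lborel borel T) B"
      by (rule nn_integral_indicator) simp
    finally show "(\<integral>\<^sup>+y. indicator E x * indicator B (x + T y) \<partial>lborel) =
        indicator E x * emeasure (distr lborel borel T) B"
      by (simp add: nn_integral_cmult)
  qed
  also have "\<dots> = emeasure lborel E * emeasure (distr lborel borel T) B"
    by (simp add: nn_integral_multc)
  finally have "emeasure lborel E * emeasure (distr lborel borel T) B = emeasure lborel E * emeasure lborel B"
    using 1 by simp
  then show "emeasure (distr lborel borel T) B = emeasure lborel B"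
    using E_pos E_fin by (simp add: ennreal_mult_cancel_left)
qed simp

lemma distr_density_invariant:
  assumes T [measurable]: "T \<in> measurable M M" and [measurable]: "f \<in> borel_measurable M"
    and "distr M M T = M" and inv: "\<And>x. f (T x) = f x"
  shows "distr (density M f) M T = density M f"
proof (rule measure_eqI)
  fix A assume "A \<in> sets (distr (density M f) M T)"
  then have [measurable]: "A \<in> sets M" by simp
  have "emeasure (distr (density M f) M T) A = (\<integral>\<^sup>+x. f x * indicator (T -` A \<inter> space M) x \<partial>M)"
    by (simp add: emeasure_distr emeasure_density)
  also have "\<dots> = (\<integral>\<^sup>+x. f (T x) * indicator A (T x) \<partial>M)"
    by (rule nn_integral_cong) (simp add: inv indicator_def)
  also have "\<dots> = (\<integral>\<^sup>+x. f x * indicator A x \<partial>distr M M T)"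
    by (simp add: nn_integral_distr)
  also have "\<dots> = emeasure (density M f) A"
    by (simp add: assms emeasure_density)
  finally show "emeasure (distr (density M f) M T) A = emeasure (density M f) A" .
qed simp

lemma distr_PiM_componentwise:
  assumes I: "finite I" and "sigma_finite_measure M" and [measurable]: "T \<in> measurable M M"
    and inv: "distr M M T = M"
  shows "distr (\<Pi>\<^sub>M i\<in>I. M) (\<Pi>\<^sub>M i\<in>I. M) (\<lambda>Y. \<lambda>i\<in>I. T (Y i)) = (\<Pi>\<^sub>M i\<in>I. M)"
proof -
  interpret sigma_finite_measure M by fact
  interpret product_sigma_finite "\<lambda>_. M" by unfold_locales
  show ?thesis
  proof (rule PiM_eqI[OF I])
    fix A assume A: "\<And>i. i \<in> I \<Longrightarrow> A i \<in> sets M"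
    have [measurable]: "Pi\<^sub>E I A \<in> sets (\<Pi>\<^sub>M i\<in>I. M)"
      using A I by (intro sets_PiM_I_finite)
    have pre: "(\<lambda>Y. \<lambda>i\<in>I. T (Y i)) -` Pi\<^sub>E I A \<inter> space (\<Pi>\<^sub>M i\<in>I. M) = (\<Pi>\<^sub>E i\<in>I. T -` A i \<inter> space M)"
      by (auto simp: space_PiM PiE_iff extensional_def)
    have "emeasure (distr (\<Pi>\<^sub>M i\<in>I. M) (\<Pi>\<^sub>M i\<in>I. M) (\<lambda>Y. \<lambda>i\<in>I. T (Y i))) (Pi\<^sub>E I A) =
        (\<Prod>i\<in>I. emeasure M (T -` A i \<inter> space M))"
      using A I by (simp add: emeasure_distr pre emeasure_PiM)
    also have "\<dots> = (\<Prod>i\<in>I. emeasure (distr M M T) (A i))"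
      using A by (simp add: emeasure_distr)
    also have "\<dots> = (\<Prod>i\<in>I. emeasure M (A i))"
      by (simp only: inv)
    finally show "emeasure (distr (\<Pi>\<^sub>M i\<in>I. M) (\<Pi>\<^sub>M i\<in>I. M) (\<lambda>Y. \<lambda>i\<in>I. T (Y i))) (Pi\<^sub>E I A) =
        (\<Prod>i\<in>I. emeasure M (A i))" .
  qed simp
qed

section \<open>Invariance of the Wishart laws under the stabilizer\<close>

lemma inner_conjugate_left:
  fixes a x y :: "'k::real_or_complex"
  shows "x \<bullet> (a * y) = (conjugate a * x) \<bullet> y"
  unfolding inner_eq_conjugate[of x] inner_eq_conjugate[of "conjugate a * x"]
  by (simp add: conjugate_dist_mul mult_ac)

lemma inner_matrix_vector:
  fixes A :: "'k::real_or_complex^2^2"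
  shows "x \<bullet> (A *v y) = (ctranspose A *v x) \<bullet> y"
  by (simp add: inner_vec_def mat2_simps inner_add_left inner_add_right inner_conjugate_left)

lemma linear_matrix_vector:
  fixes A :: "'k::real_or_complex^2^2"
  shows "linear ((*v) A)"
  by (rule linearI) (simp_all add: mat2_simps algebra_simps)

lemma continuous_on_matrix_vector [continuous_intros]:
  fixes A :: "'k::real_or_complex^2^2"
  assumes "continuous_on S f"
  shows "continuous_on S (\<lambda>x. A *v f x)"
  using linear_matrix_vector[of A] assms
  by (auto simp: linear_conv_bounded_linear intro: bounded_linear.continuous_on)

lemma norm_matrix_vector_isometry:
  fixes W :: "'k::real_or_complex^2^2"
  assumes "W ** ctranspose W = mat 1"
  shows "norm (W *v v) = norm v"
proof -
  have "(W *v v) \<bullet> (W *v v) = (ctranspose W ** W *v v) \<bullet> v"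
    by (simp add: inner_matrix_vector matrix_vector_mul_assoc)
  then show ?thesis
    by (simp add: right_inverse_is_left_inverse[OF assms] norm_eq_sqrt_inner)
qed

text \<open>\<open>E\<close> is the open unit ball of the norm given by the inverse of
  \<open>S\<close>. Since \<open>G\<close> fixes \<open>S\<close>, conjugation by the square root of
  \<open>S\<close> turns \<open>G\<close> into the unitary matrix \<open>W\<close>, so
  \<open>G\<close> preserves this ellipsoid.\<close>

lemma lborel_stabilizer_invariant:
  fixes S G :: "'k::real_or_complex^2^2"
  assumes S: "S \<in> P2" and G: "det G = 1" and fixed: "cong_act G S = S"
  shows "distr lborel borel ((*v) G) = lborel"
proof -
  define R where "R = mat_sqrt S"
  have R: "R \<in> P2" "R ** R = S" "det R \<noteq> 0"
    using mat_sqrt_P2[OF S] P2_det_nonzero by (auto simp: R_def)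
  have Rh: "ctranspose R = R" "ctranspose (matrix_inv R) = matrix_inv R"
    using P2_hermitian[OF R(1)] ctranspose_matrix_inv[OF R(3)] by simp_all
  note Rinv = matrix_inv_mult[OF R(3)]
  define E where "E = {y. norm (matrix_inv R *v y) < 1}"
  define W where "W = matrix_inv R ** G ** R"
  have "W ** ctranspose W = matrix_inv R ** cong_act G (R ** R) ** matrix_inv R"
    by (simp only: W_def ctranspose_mult Rh matrix_mul_assoc)
  also have "\<dots> = (matrix_inv R ** R) ** (R ** matrix_inv R)"
    by (simp only: R(2) fixed) (simp only: R(2)[symmetric] matrix_mul_assoc)
  finally have W: "W ** ctranspose W = mat 1"
    by (simp only: Rinv matrix_mul_lid)
  have WG: "W ** matrix_inv R = matrix_inv R ** G"
    by (simp only: W_def Rinv matrix_mul_rid flip: matrix_mul_assoc)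
  show ?thesis
  proof (rule lborel_distr_linear[where E = E and T' = "(*v) (matrix_inv G)"])
    show "linear ((*v) G)" by (rule linear_matrix_vector)
    show "G *v (matrix_inv G *v x) = x" for x
      using G by (simp add: matrix_vector_mul_assoc matrix_inv_mult)
    show "open E"
      unfolding E_def by (intro open_Collect_less continuous_intros)
    have "E \<subseteq> (*v) R ` ball 0 1"
    proof
      fix y assume "y \<in> E"
      then have "y = R *v (matrix_inv R *v y)" "matrix_inv R *v y \<in> ball 0 1"
        by (simp_all add: E_def matrix_vector_mul_assoc Rinv)
      then show "y \<in> (*v) R ` ball 0 1" by (rule image_eqI)
    qed
    moreover have "bounded ((*v) R ` ball 0 1)"
      using linear_matrix_vector[of R] by (simp add: bounded_linear_image linear_conv_bounded_linear)
    ultimately show "bounded E" by (rule bounded_subset[rotated])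
    show "0 \<in> E" by (simp add: E_def)
    show "- x \<in> E \<longleftrightarrow> x \<in> E" for x
      using linear_neg[OF linear_matrix_vector[of "matrix_inv R"]] by (simp add: E_def)
    show "G *v x \<in> E \<longleftrightarrow> x \<in> E" for x
    proof -
      have "matrix_inv R *v (G *v x) = W *v (matrix_inv R *v x)"
        by (simp only: matrix_vector_mul_assoc WG)
      then show ?thesis
        by (simp add: E_def norm_matrix_vector_isometry[OF W])
    qed
  qed
qed

lemma sets_gaussian_law [simp]:
  "sets (gaussian_law S) = sets borel" "space (gaussian_law S) = UNIV"
  by (simp_all add: gaussian_law_def)

lemma borel_measurable_gaussian_density:
  fixes A :: "'k::real_or_complex^2^2"
  shows "(\<lambda>y. ennreal (c * exp (k * (y \<bullet> (A *v y))))) \<in> borel_measurable borel"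
proof -
  have "continuous_on UNIV (\<lambda>y. c * exp (k * (y \<bullet> (A *v y))))"
    by (intro continuous_intros)
  then have "(\<lambda>y. c * exp (k * (y \<bullet> (A *v y)))) \<in> borel_measurable borel"
    by (rule borel_measurable_continuous_onI)
  then show ?thesis by measurable
qed

text \<open>The product measure argument asks for sigma-finiteness, which follows from the density
  having finite values.\<close>

lemma sigma_finite_gaussian_law:
  fixes S :: "'k::real_or_complex^2^2"
  shows "sigma_finite_measure (gaussian_law S)"
  unfolding gaussian_law_def
  by (subst sigma_finite_measure.sigma_finite_iff_density_finite[OF sigma_finite_lborel])
    (simp_all only: measurable_lborel2 borel_measurable_gaussian_density ennreal_neq_top
      infinity_ennreal_def not_False_eq_True eventually_True)

text \<open>Lebesgue measure is preserved, and so is the exponent: inverting the fixed point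
  equation for \<open>S\<close> shows that congruence by \<open>ctranspose G\<close> fixes
  \<open>matrix_inv S\<close>.\<close>

lemma gaussian_law_invariant:
  fixes S G :: "'k::real_or_complex^2^2"
  assumes S: "S \<in> P2" and G: "det G = 1" and fixed: "cong_act G S = S"
  shows "distr (gaussian_law S) (gaussian_law S) ((*v) G) = gaussian_law S"
proof -
  have Si: "S ** matrix_inv S = mat 1"
    using P2_det_nonzero[OF S] by (rule matrix_inv_mult)
  have "G ** (S ** ctranspose G ** matrix_inv S) = mat 1"
    using Si fixed by (simp add: matrix_mul_assoc)
  then have "S ** ctranspose G ** matrix_inv S ** G = mat 1"
    by (rule right_inverse_is_left_inverse)
  then have "S ** (ctranspose G ** matrix_inv S ** G) = mat 1"
    by (simp add: matrix_mul_assoc)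
  then have inv: "matrix_inv S = ctranspose G ** matrix_inv S ** G"
    by (rule matrix_inv_unique)
  have *: "(G *v y) \<bullet> (matrix_inv S *v (G *v y)) = y \<bullet> (matrix_inv S *v y)" for y
  proof -
    have "(G *v y) \<bullet> (matrix_inv S *v (G *v y)) = y \<bullet> (ctranspose G *v (matrix_inv S *v (G *v y)))"
      by (simp add: inner_matrix_vector[of y])
    also have "\<dots> = y \<bullet> ((ctranspose G ** matrix_inv S ** G) *v y)"
      by (simp only: matrix_vector_mul_assoc matrix_mul_assoc)
    finally show ?thesis by (simp only: inv[symmetric])
  qed
  have [measurable]: "(*v) G \<in> borel_measurable borel"
    by (intro borel_measurable_continuous_onI continuous_intros)
  have "distr (gaussian_law S) lborel ((*v) G) = gaussian_law S"
    unfolding gaussian_law_def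
  proof (rule distr_density_invariant)
    show "distr lborel lborel ((*v) G) = lborel"
      unfolding distr_cong[OF refl sets_lborel refl] by (rule lborel_stabilizer_invariant[OF assms])
    show "(*v) G \<in> measurable lborel lborel"
      by simp
    show "(\<lambda>y. ennreal ((DIM('k) / (2 * pi)) ^ DIM('k) * norm (det S) powr (- real DIM('k) / 2) *
        exp (- (real DIM('k) / 2) * (y \<bullet> (matrix_inv S *v y))))) \<in> borel_measurable lborel"
      unfolding measurable_lborel2 by (rule borel_measurable_gaussian_density)
  qed (simp only: *)
  moreover have "distr (gaussian_law S) (gaussian_law S) ((*v) G) = distr (gaussian_law S) lborel ((*v) G)"
    by (rule distr_cong) simp_all
  ultimately show ?thesis by (simp only:)
qed

section \<open>Continuity and measurability of the matrix operations\<close>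

lemma continuous_on_matrix_mult [continuous_intros]:
  fixes f g :: "'a::topological_space \<Rightarrow> 'k::real_or_complex^2^2"
  assumes "continuous_on S f" "continuous_on S g"
  shows "continuous_on S (\<lambda>x. f x ** g x)"
  unfolding matrix_matrix_mult_def
  by (intro continuous_on_vec_lambda continuous_intros assms)

lemma continuous_on_conjugate [continuous_intros]:
  fixes f :: "'a::topological_space \<Rightarrow> 'k::real_or_complex"
  shows "continuous_on S f \<Longrightarrow> continuous_on S (\<lambda>x. conjugate (f x))"
  by (rule bounded_linear.continuous_on[OF bounded_linear_conjugate])

lemma continuous_on_ctranspose [continuous_intros]:
  fixes f :: "'a::topological_space \<Rightarrow> 'k::real_or_complex^2^2"
  assumes "continuous_on S f"
  shows "continuous_on S (\<lambda>x. ctranspose (f x))"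
  unfolding ctranspose_def
  by (intro continuous_on_vec_lambda continuous_intros assms)

lemma continuous_on_outer [continuous_intros]:
  fixes f :: "'a::topological_space \<Rightarrow> 'k::real_or_complex^2"
  assumes "continuous_on S f"
  shows "continuous_on S (\<lambda>x. outer (f x))"
  unfolding outer_def
  by (intro continuous_on_vec_lambda continuous_intros assms)

lemma continuous_on_det2 [continuous_intros]:
  fixes f :: "'a::topological_space \<Rightarrow> 'k::real_or_complex^2^2"
  assumes "continuous_on S f"
  shows "continuous_on S (\<lambda>x. det (f x))"
  unfolding det_2 by (intro continuous_intros assms)

lemma measurable_cong_act [measurable]:
  fixes G :: "'k::real_or_complex^2^2"
  shows "cong_act G \<in> borel_measurable borel"
  by (intro borel_measurable_continuous_onI continuous_intros)

lemma measurable_outer [measurable]: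
  "(outer :: 'k::real_or_complex^2 \<Rightarrow> 'k^2^2) \<in> borel_measurable borel"
  by (intro borel_measurable_continuous_onI continuous_intros)

lemma P2_borel [measurable]: "(P2 :: ('k::real_or_complex^2^2) set) \<in> sets borel"
proof -
  have "P2 = {X :: 'k^2^2. ctranspose X = X} \<inter> {X. 0 < 1 \<bullet> trace X} \<inter> {X. 0 < 1 \<bullet> det X}"
    using P2_iff_trace_det by blast
  also have "\<dots> \<in> sets borel"
    unfolding trace_def
    by (intro sets.Int borel_closed borel_open closed_Collect_eq open_Collect_less continuous_intros)
  finally show ?thesis .
qed

lemma S2_borel [measurable]: "(S2 :: ('k::real_or_complex^2^2) set) \<in> sets borel"
proof -
  have "S2 = P2 \<inter> {X :: 'k^2^2. det X = 1}"
    by (auto simp: S2_def)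
  also have "\<dots> \<in> sets borel"
    by (intro sets.Int P2_borel borel_closed closed_Collect_eq continuous_intros)
  finally show ?thesis .
qed

lemma proj_S2_mem:
  fixes X :: "'k::real_or_complex^2^2"
  assumes "X \<in> P2"
  shows "proj_S2 X \<in> S2"
proof -
  obtain d where d: "0 < d" "det X = of_real d"
    using assms by (rule P2_det)
  define r where "r = norm (det X) powr (- 1 / 2)"
  have "r > 0" using d by (simp add: r_def)
  have "r * r * d = 1"
    using d by (simp add: r_def powr_minus field_simps flip: powr_add)
  have proj: "proj_S2 X = r *\<^sub>R X"
    by (simp add: proj_S2_def r_def)
  \<comment> \<open>Scaling by \<open>r\<close> is congruence by \<open>sqrt r\<close> times the
    identity, so positivity is inherited from \<open>P2_cong_act\<close>.\<close>
  have "r *\<^sub>R X = cong_act (diag2 (sqrt r) (sqrt r)) X"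
    unfolding vec_eq_iff forall_2 vector_scaleR_component
    unfolding scaleR_conv_of_real
    using \<open>r > 0\<close> by (simp add: mat2_simps mult_ac flip: of_real_mult)
  moreover have "cong_act (diag2 (sqrt r) (sqrt r)) X \<in> P2"
    using \<open>r > 0\<close> by (intro P2_cong_act assms) (simp add: det_2)
  ultimately have "r *\<^sub>R X \<in> P2"
    by (simp only:)
  moreover have "det (r *\<^sub>R X) = of_real (r * r) * det X"
    unfolding det_2 vector_scaleR_component
    unfolding scaleR_conv_of_real by (simp add: algebra_simps)
  ultimately show ?thesis
    using \<open>r * r * d = 1\<close> by (simp add: S2_def proj d(2) flip: of_real_mult)
qed

lemma measurable_proj_S2 [measurable]:
  "(proj_S2 :: 'k::real_or_complex^2^2 \<Rightarrow> _) \<in> measurable borel borel"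
proof -
  have [measurable]: "(det :: 'k^2^2 \<Rightarrow> _) \<in> borel_measurable borel"
    by (intro borel_measurable_continuous_onI continuous_intros)
  show ?thesis
    unfolding proj_S2_def by measurable
qed

lemma proj_S2_cong_act:
  fixes G X :: "'k::real_or_complex^2^2"
  assumes "det G = 1"
  shows "proj_S2 (cong_act G X) = cong_act G (proj_S2 X)"
proof -
  have "det (cong_act G X) = det X"
    using assms by (simp add: det_cong_act)
  then show ?thesis
    by (simp only: proj_S2_def matrix_mul_scaleR)
qed

section \<open>From the Gaussian to the projective Wishart law\<close>

lemma sets_wishart [simp]: "sets (wishart S n) = sets borel" "space (wishart S n) = UNIV"
  by (simp_all add: wishart_def)

text \<open>Congruence of an outer product by \<open>G\<close> is the outer product of the moved
  vector. Acting on the sum therefore means acting on every sample, and the joint law of the samples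
  is preserved componentwise.\<close>

lemma wishart_invariant:
  fixes S G :: "'k::real_or_complex^2^2"
  assumes S: "S \<in> P2" and G: "det G = 1" and fixed: "cong_act G S = S"
  shows "distr (wishart S n) borel (cong_act G) = wishart S n"
proof -
  let ?N = "\<Pi>\<^sub>M i\<in>{1..n}. gaussian_law S"
  let ?W = "\<lambda>Y. \<Sum>i\<in>{1..n}. outer (Y i)"
  let ?T = "\<lambda>Y. \<lambda>i\<in>{1..n}. G *v Y i"
  have Gm [measurable]: "(*v) G \<in> measurable (gaussian_law S) (gaussian_law S)"
    unfolding measurable_cong_sets[OF sets_gaussian_law(1) sets_gaussian_law(1)]
    by (intro borel_measurable_continuous_onI continuous_intros)
  have [measurable]: "outer \<in> measurable (gaussian_law S) borel"
    unfolding measurable_cong_sets[OF sets_gaussian_law(1) refl] by (rule measurable_outer)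
  have W [measurable]: "?W \<in> borel_measurable ?N"
    by measurable
  have T [measurable]: "?T \<in> measurable ?N ?N"
    by measurable
  have "distr (wishart S n) borel (cong_act G) = distr ?N borel (cong_act G \<circ> ?W)"
    unfolding wishart_def by (rule distr_distr) measurable
  also have "cong_act G \<circ> ?W = ?W \<circ> ?T"
  proof
    fix Y :: "nat \<Rightarrow> 'k^2"
    have lin: "linear (cong_act G)"
      by (rule linearI) (simp_all add: matrix_add_ldistrib matrix_add_rdistrib matrix_mul_scaleR)
    have "cong_act G (outer y) = outer (G *v y)" for y
      by (simp add: outer_def mat2_simps conjugate_dist_add conjugate_dist_mul algebra_simps)
    then show "(cong_act G \<circ> ?W) Y = (?W \<circ> ?T) Y"
      by (simp add: linear_sum[OF lin])
  qed
  also have "distr ?N borel (?W \<circ> ?T) = distr (distr ?N ?N ?T) borel ?W"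
    by (rule distr_distr[symmetric]) measurable
  also have "distr ?N ?N ?T = ?N"
    by (rule distr_PiM_componentwise[OF finite_atLeastAtMost sigma_finite_gaussian_law Gm
      gaussian_law_invariant[OF assms]])
  also have "distr ?N borel ?W = wishart S n"
    by (simp only: wishart_def)
  finally show ?thesis .
qed

lemma sets_proj_wishart [simp]:
  "sets (proj_wishart S n) = sets (restrict_space borel S2)" "space (proj_wishart S n) = S2"
  unfolding proj_wishart_def sets_distr space_distr space_restrict_space by simp_all

text \<open>Rewrites the law over the full matrix space, where the invariance of the Wishart law is
  available.\<close>

lemma emeasure_proj_wishart:
  fixes S :: "'k::real_or_complex^2^2"
  assumes "A \<in> sets (restrict_space borel S2)"
  shows "emeasure (proj_wishart S n) A = emeasure (wishart S n) {X \<in> P2. proj_S2 X \<in> A}"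
proof -
  have "proj_S2 \<in> measurable (restrict_space (wishart S n) P2) (restrict_space borel S2)"
  proof (rule measurable_restrict_space2)
    show "proj_S2 \<in> measurable (restrict_space (wishart S n) P2) borel"
      by (rule measurable_restrict_space1)
        (simp only: measurable_cong_sets[OF sets_wishart(1) refl] measurable_proj_S2)
  qed (simp add: space_restrict_space proj_S2_mem)
  then have "emeasure (proj_wishart S n) A =
      emeasure (restrict_space (wishart S n) P2) (proj_S2 -` A \<inter> space (restrict_space (wishart S n) P2))"
    unfolding proj_wishart_def using assms by (rule emeasure_distr)
  also have "\<dots> = emeasure (wishart S n) (proj_S2 -` A \<inter> space (restrict_space (wishart S n) P2))"
    by (rule emeasure_restrict_space) (auto simp: space_restrict_space)
  also have "proj_S2 -` A \<inter> space (restrict_space (wishart S n) P2) = {X \<in> P2. proj_S2 X \<in> A}"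
    by (auto simp: space_restrict_space)
  finally show ?thesis .
qed

lemma measurable_cong_act_S2:
  fixes G :: "'k::real_or_complex^2^2"
  assumes "det G = 1"
  shows "cong_act G \<in> measurable (restrict_space borel S2) (restrict_space borel S2)"
  using assms by (intro measurable_restrict_space2 measurable_restrict_space1)
    (auto simp: space_restrict_space S2_cong_act_iff)

text \<open>With determinant 1, congruence leaves the determinant of \<open>X\<close> unchanged and
  hence commutes with the projection; it also preserves \<open>P2\<close>.\<close>

lemma proj_wishart_invariant:
  fixes S G :: "'k::real_or_complex^2^2"
  assumes S: "S \<in> P2" and G: "det G = 1" and fixed: "cong_act G S = S"
    and A: "A \<in> sets (restrict_space borel S2)"
  shows "emeasure (proj_wishart S n) (cong_act G -` A \<inter> S2) = emeasure (proj_wishart S n) A"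
proof -
  have "A \<in> sets borel"
    using A by (simp add: sets_restrict_space_iff)
  then have [measurable]: "{X \<in> P2. proj_S2 X \<in> A} \<in> sets borel"
    by measurable
  have "cong_act G -` A \<inter> S2 \<in> sets (restrict_space borel S2)"
    using measurable_sets[OF measurable_cong_act_S2[OF G] A] by (simp add: space_restrict_space)
  then have "emeasure (proj_wishart S n) (cong_act G -` A \<inter> S2) =
      emeasure (wishart S n) {X \<in> P2. proj_S2 X \<in> cong_act G -` A \<inter> S2}"
    by (rule emeasure_proj_wishart)
  also have "{X \<in> P2. proj_S2 X \<in> cong_act G -` A \<inter> S2} =
      cong_act G -` {X \<in> P2. proj_S2 X \<in> A} \<inter> space (wishart S n)"
    using G by (auto simp: proj_S2_mem P2_cong_act_iff proj_S2_cong_act)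
  also have "emeasure (wishart S n) \<dots> = emeasure (distr (wishart S n) borel (cong_act G)) {X \<in> P2. proj_S2 X \<in> A}"
    unfolding measurable_cong_sets[OF sets_wishart(1) refl]
    by (rule emeasure_distr[symmetric])
      (simp_all only: measurable_cong_sets[OF sets_wishart(1) refl] measurable_cong_act, measurable)
  also have "\<dots> = emeasure (proj_wishart S n) A"
    using A by (simp add: wishart_invariant[OF S G fixed] emeasure_proj_wishart)
  finally show ?thesis .
qed

section \<open>Densities with respect to an invariant volume\<close>

lemma invariant_volumeD:
  assumes "invariant_volume \<nu>"
  shows "space \<nu> = S2" "sets \<nu> = sets (restrict_space borel S2)" "emeasure \<nu> S2 \<noteq> 0"
    "\<And>G A. det G = 1 \<Longrightarrow> A \<in> sets \<nu> \<Longrightarrow> emeasure \<nu> (cong_act G ` A) = emeasure \<nu> A"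
  using assms by (simp_all add: invariant_volume_def)

text \<open>\<open>invariant_volume\<close> speaks of images, pushforwards of preimages; these
  identities pass from one form to the other.\<close>

lemma cong_act_vimage_inverse:
  fixes G :: "'k::real_or_complex^2^2"
  assumes G: "det G = 1" and "A \<subseteq> S2"
  shows "cong_act G -` (cong_act (matrix_inv G) -` A \<inter> S2) \<inter> S2 = A"
    "cong_act G ` (cong_act G -` A \<inter> S2) = A"
proof -
  have inv: "cong_act G (cong_act (matrix_inv G) x) = x" "cong_act (matrix_inv G) (cong_act G x) = x" for x
    using G cong_act_cong_act[of G "matrix_inv G" x] cong_act_cong_act[of "matrix_inv G" G x]
    by (simp_all add: matrix_inv_mult)
  have mem: "cong_act G x \<in> S2 \<longleftrightarrow> x \<in> S2" "cong_act (matrix_inv G) x \<in> S2 \<longleftrightarrow> x \<in> S2" for x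
    using G S2_cong_act_iff[of G x] S2_cong_act_iff[of "matrix_inv G" x] by (simp_all add: det_matrix_inv)
  show "cong_act G -` (cong_act (matrix_inv G) -` A \<inter> S2) \<inter> S2 = A"
    using assms(2) by (auto simp only: vimage_eq Int_iff inv mem)
  show "cong_act G ` (cong_act G -` A \<inter> S2) = A"
  proof (intro equalityI subsetI)
    fix x assume "x \<in> A"
    then have "cong_act (matrix_inv G) x \<in> cong_act G -` A \<inter> S2"
      using assms(2) by (auto simp only: vimage_eq Int_iff inv mem)
    then show "x \<in> cong_act G ` (cong_act G -` A \<inter> S2)"
      by (rule rev_image_eqI) (simp only: inv)
  qed auto
qed

lemma measurable_cong_act_invariant_volume:
  fixes \<nu> :: "('k::real_or_complex^2^2) measure"
  assumes "invariant_volume \<nu>" "det G = 1"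
  shows "cong_act G \<in> measurable \<nu> \<nu>"
  unfolding measurable_cong_sets[OF invariant_volumeD(2)[OF assms(1)] invariant_volumeD(2)[OF assms(1)]]
  by (rule measurable_cong_act_S2[OF assms(2)])

lemma invariant_volume_distr:
  fixes \<nu> :: "('k::real_or_complex^2^2) measure"
  assumes \<nu>: "invariant_volume \<nu>" and G: "det G = 1"
  shows "distr \<nu> \<nu> (cong_act G) = \<nu>"
proof (rule measure_eqI)
  fix A assume "A \<in> sets (distr \<nu> \<nu> (cong_act G))"
  then have A: "A \<in> sets \<nu>" by simp
  note meas = measurable_cong_act_invariant_volume[OF assms]
  have sub: "A \<subseteq> S2"
    using sets.sets_into_space[OF A] by (simp add: invariant_volumeD[OF \<nu>])
  have B: "cong_act G -` A \<inter> S2 \<in> sets \<nu>"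
    using measurable_sets[OF meas A] by (simp add: invariant_volumeD[OF \<nu>])
  have "emeasure (distr \<nu> \<nu> (cong_act G)) A = emeasure \<nu> (cong_act G -` A \<inter> S2)"
    using emeasure_distr[OF meas A] by (simp add: invariant_volumeD[OF \<nu>])
  also have "\<dots> = emeasure \<nu> (cong_act G ` (cong_act G -` A \<inter> S2))"
    by (rule invariant_volumeD(4)[OF \<nu> G B, symmetric])
  also have "\<dots> = emeasure \<nu> A"
    by (simp only: cong_act_vimage_inverse[OF G sub])
  finally show "emeasure (distr \<nu> \<nu> (cong_act G)) A = emeasure \<nu> A" .
qed simp

lemma openin_S2_sets:
  fixes \<nu> :: "('k::real_or_complex^2^2) measure"
  assumes "invariant_volume \<nu>" "openin (top_of_set S2) U"
  shows "U \<in> sets \<nu>"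
proof -
  obtain T where "open T" "U = S2 \<inter> T"
    using assms(2) by (auto simp: openin_open)
  then show ?thesis
    by (simp add: invariant_volumeD[OF assms(1)] sets_restrict_space_iff)
qed

text \<open>By transitivity the translates of \<open>U\<close> cover \<open>S2\<close>, and countably many of them suffice.\<close>

lemma invariant_volume_open_nonzero:
  fixes \<nu> :: "('k::real_or_complex^2^2) measure"
  assumes \<nu>: "invariant_volume \<nu>" and U: "openin (top_of_set S2) U" "U \<noteq> {}"
  shows "emeasure \<nu> U \<noteq> 0"
proof
  assume null: "emeasure \<nu> U = 0"
  have U_sets: "U \<in> sets \<nu>"
    by (rule openin_S2_sets[OF \<nu> U(1)])
  define F where "F = {S2 \<inter> cong_act G -` U | G. det G = 1}"
  have open_F: "openin (top_of_set S2) V" if V: "V \<in> F" for V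
  proof -
    obtain G where G: "det G = 1" "V = S2 \<inter> cong_act G -` U"
      using V unfolding F_def by blast
    have "continuous_on S2 (cong_act G)"
      by (intro continuous_intros)
    moreover have "cong_act G \<in> S2 \<rightarrow> S2"
      using G by (auto simp: S2_cong_act_iff)
    ultimately show ?thesis
      unfolding G(2) by (rule continuous_openin_preimage[OF _ _ U(1)])
  qed
  then obtain F' where F': "F' \<subseteq> F" "countable F'" "\<Union>F' = \<Union>F"
    by (rule Lindelof_openin)
  have "V \<in> null_sets \<nu>" if V: "V \<in> F'" for V
  proof
    obtain G where G: "det G = 1" "V = S2 \<inter> cong_act G -` U"
      using V F'(1) unfolding F_def by blast
    show "V \<in> sets \<nu>"
      using V F'(1) open_F by (blast intro: openin_S2_sets[OF \<nu>])
    have "emeasure \<nu> V = emeasure (distr \<nu> \<nu> (cong_act G)) U"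
      unfolding emeasure_distr[OF measurable_cong_act_invariant_volume[OF \<nu> G(1)] U_sets]
      by (simp add: G(2) invariant_volumeD[OF \<nu>] Int_commute)
    then show "emeasure \<nu> V = 0"
      by (simp only: invariant_volume_distr[OF \<nu> G(1)] null)
  qed
  then have "\<Union>F' \<in> null_sets \<nu>"
    using null_sets_UN'[of F' id \<nu>] F'(2) by simp
  moreover have "\<Union>F = S2"
  proof (intro equalityI subsetI)
    fix x :: "'k^2^2" assume x: "x \<in> S2"
    obtain u where u: "u \<in> U" using U by blast
    then have "u \<in> S2" using openin_imp_subset[OF U(1)] by blast
    with x obtain G where "det G = 1" "cong_act G x = u"
      by (rule S2_transitive)
    with x u show "x \<in> \<Union>F"
      unfolding F_def by blast
  qed (auto simp: F_def)
  ultimately show False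
    using F'(3) invariant_volumeD(3)[OF \<nu>] by auto
qed

section \<open>From set integrals to pointwise statements\<close>

lemma AE_nonneg_if_set_integrals_nonneg:
  fixes g :: "'a \<Rightarrow> real"
  assumes g: "integrable M g" and pos: "\<And>A. A \<in> sets M \<Longrightarrow> 0 \<le> (LINT x:A|M. g x)"
  shows "AE x in M. 0 \<le> g x"
proof -
  have [measurable]: "g \<in> borel_measurable M" using g by auto
  define A where "A = {x \<in> space M. g x < 0}"
  have A [measurable]: "A \<in> sets M" unfolding A_def by measurable
  \<comment> \<open>Nonnegative by the choice of \<open>A\<close>, while the hypothesis at
    \<open>A\<close> makes its integral nonpositive; so it vanishes almost everywhere.\<close>
  define k where "k x = - (indicator A x * g x)" for x
  have int: "integrable M k"
    unfolding k_def using integrable_mult_indicator[OF A g] by simp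
  have nonneg: "AE x in M. 0 \<le> k x"
    by (rule AE_I2) (auto simp: k_def A_def indicator_def)
  have "(\<integral>x. k x \<partial>M) = - (LINT x:A|M. g x)"
    by (simp add: k_def set_lebesgue_integral_def)
  also have "\<dots> \<le> 0"
    using pos[OF A] by simp
  finally have "(\<integral>x. k x \<partial>M) = 0"
    using integral_nonneg_AE[OF nonneg] by linarith
  then have "AE x in M. k x = 0"
    using integral_nonneg_eq_0_iff_AE[OF int nonneg] by simp
  moreover have "AE x in M. x \<in> space M" by simp
  ultimately show ?thesis
    by eventually_elim (auto simp: k_def A_def indicator_def split: if_splits)
qed

text \<open>By continuity a negative value would persist on a nonempty relatively open set, which
  would be null.\<close>

lemma continuous_nonneg_if_set_integrals_nonneg:
  fixes \<nu> :: "('k::real_or_complex^2^2) measure" and g :: "'k^2^2 \<Rightarrow> real"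
  assumes \<nu>: "invariant_volume \<nu>" and g: "integrable \<nu> g" and cont: "continuous_on S2 g"
    and pos: "\<And>A. A \<in> sets \<nu> \<Longrightarrow> 0 \<le> (LINT x:A|\<nu>. g x)" and x: "x \<in> S2"
  shows "0 \<le> g x"
proof (rule ccontr)
  assume neg: "\<not> 0 \<le> g x"
  define U where "U = S2 \<inter> g -` {..<0}"
  have U: "openin (top_of_set S2) U"
    unfolding U_def by (rule continuous_openin_preimage_gen[OF cont open_lessThan])
  have "AE x in \<nu>. 0 \<le> g x"
    using g pos by (rule AE_nonneg_if_set_integrals_nonneg)
  then have "AE x in \<nu>. x \<notin> U"
    by eventually_elim (simp add: U_def)
  then have "emeasure \<nu> U = 0"
    using openin_S2_sets[OF \<nu> U] by (simp add: AE_iff_measurable[OF _ refl] AE_iff_null_sets null_setsD1)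
  moreover have "x \<in> U"
    using neg x by (simp add: U_def)
  ultimately show False
    using invariant_volume_open_nonzero[OF \<nu> U] by blast
qed

lemma pw_densityD:
  assumes "pw_density \<nu> S n f"
  shows "continuous_on S2 f" "integrable \<nu> f"
    "\<And>A. A \<in> sets \<nu> \<Longrightarrow> measure (proj_wishart S n) A = (LINT x:A|\<nu>. f x)"
  using assms by (auto simp: pw_density_def)

text \<open>\<open>pw_density\<close> leaves the sign of \<open>f\<close> open; nonnegativity comes
  from its set integrals being values of a measure.\<close>

lemma pw_density_nonneg:
  fixes S :: "'k::real_or_complex^2^2"
  assumes \<nu>: "invariant_volume \<nu>" and f: "pw_density \<nu> S n f" and x: "x \<in> S2"
  shows "0 \<le> f x"
proof (rule continuous_nonneg_if_set_integrals_nonneg[OF \<nu> pw_densityD(2,1)[OF f] _ x])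
  show "0 \<le> (LINT x:A|\<nu>. f x)" if "A \<in> sets \<nu>" for A
    using pw_densityD(3)[OF f that] measure_nonneg[of "proj_wishart S n" A] by simp
qed

text \<open>Composing \<open>f\<close> with the action gives another continuous density of the same
  law, because both the law and the volume are invariant. Two such densities agree
  everywhere.\<close>

lemma pw_density_stabilizer_invariant:
  fixes S G :: "'k::real_or_complex^2^2"
  assumes S: "S \<in> P2" and \<nu>: "invariant_volume \<nu>" and f: "pw_density \<nu> S n f"
    and G: "det G = 1" and fixed: "cong_act G S = S" and x: "x \<in> S2"
  shows "f (cong_act G x) = f x"
proof -
  note meas = measurable_cong_act_invariant_volume[OF \<nu> G]
  have fint: "integrable \<nu> f" and [measurable]: "f \<in> borel_measurable \<nu>"
    using pw_densityD(2)[OF f] by auto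
  have fint': "integrable \<nu> (\<lambda>x. f (cong_act G x))"
    using integrable_distr_eq[OF meas, of f] fint by (simp add: invariant_volume_distr[OF \<nu> G])
  have cont': "continuous_on S2 (\<lambda>x. f (cong_act G x))"
    by (rule continuous_on_compose2[OF pw_densityD(1)[OF f]])
      (use G in \<open>auto intro!: continuous_intros simp: S2_cong_act_iff\<close>)
  have eq: "(LINT x:B|\<nu>. f (cong_act G x)) = (LINT x:B|\<nu>. f x)" if B: "B \<in> sets \<nu>" for B
  proof -
    \<comment> \<open>The image of \<open>B\<close> under \<open>G\<close>, written as a preimage
      under the inverse so that measurability is immediate.\<close>
    define A where "A = cong_act (matrix_inv G) -` B \<inter> S2"
    have Gi: "det (matrix_inv G) = 1" using G by (simp add: det_matrix_inv)
    have A: "A \<in> sets \<nu>"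
      using measurable_sets[OF measurable_cong_act_invariant_volume[OF \<nu> Gi] B]
      by (simp add: A_def invariant_volumeD[OF \<nu>])
    have AB: "cong_act G -` A \<inter> S2 = B"
      unfolding A_def using sets.sets_into_space[OF B]
      by (intro cong_act_vimage_inverse[OF G]) (simp add: invariant_volumeD[OF \<nu>])
    have "(LINT x:B|\<nu>. f x) = measure (proj_wishart S n) B"
      by (rule pw_densityD(3)[OF f B, symmetric])
    also have "\<dots> = measure (proj_wishart S n) A"
      using proj_wishart_invariant[OF S G fixed, of A n] A
      unfolding AB by (simp add: measure_def invariant_volumeD[OF \<nu>])
    also have "\<dots> = (LINT x:A|\<nu>. f x)"
      by (rule pw_densityD(3)[OF f A])
    also have "\<dots> = (\<integral>x. indicator A x *\<^sub>R f x \<partial>distr \<nu> \<nu> (cong_act G))"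
      by (simp only: set_lebesgue_integral_def invariant_volume_distr[OF \<nu> G])
    also have "\<dots> = (\<integral>x. indicator A (cong_act G x) *\<^sub>R f (cong_act G x) \<partial>\<nu>)"
      by (intro integral_distr meas borel_measurable_scaleR borel_measurable_indicator A
        borel_measurable_integrable fint)
    also have "\<dots> = (LINT x:B|\<nu>. f (cong_act G x))"
      unfolding set_lebesgue_integral_def
      by (rule Bochner_Integration.integral_cong[OF refl])
        (auto simp: AB[symmetric] indicator_def invariant_volumeD[OF \<nu>])
    finally show ?thesis ..
  qed
  have si: "set_integrable \<nu> B f" "set_integrable \<nu> B (\<lambda>x. f (cong_act G x))" if "B \<in> sets \<nu>" for B
    unfolding set_integrable_def by (rule integrable_mult_indicator[OF that fint],
      rule integrable_mult_indicator[OF that fint'])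
  \<comment> \<open>Equality is obtained as two inequalities, since the pointwise criterion is one
    for nonnegativity.\<close>
  have "0 \<le> f (cong_act G x) - f x"
  proof (rule continuous_nonneg_if_set_integrals_nonneg[OF \<nu> _ _ _ x])
    show "0 \<le> (LINT x:A|\<nu>. f (cong_act G x) - f x)" if "A \<in> sets \<nu>" for A
      unfolding set_integral_diff(2)[OF si(2,1)[OF that]] by (simp add: eq[OF that])
  qed (intro Bochner_Integration.integrable_diff continuous_on_diff fint fint' cont' pw_densityD(1)[OF f])+
  moreover have "0 \<le> f x - f (cong_act G x)"
  proof (rule continuous_nonneg_if_set_integrals_nonneg[OF \<nu> _ _ _ x])
    show "0 \<le> (LINT x:A|\<nu>. f x - f (cong_act G x))" if "A \<in> sets \<nu>" for A
      unfolding set_integral_diff(2)[OF si[OF that]] by (simp add: eq[OF that])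
  qed (intro Bochner_Integration.integrable_diff continuous_on_diff fint fint' cont' pw_densityD(1)[OF f])+
  ultimately show ?thesis by simp
qed

section \<open>Factorization through the distance\<close>

lemma pw_density_factors_through_dist:
  fixes S :: "'k::real_or_complex^2^2"
  assumes S: "S \<in> P2" and \<nu>: "invariant_volume \<nu>" and f: "pw_density \<nu> S n f" and c: "c > 0"
  obtains h :: "real \<Rightarrow> real" where "\<forall>t\<ge>0. h t \<ge> 0" "\<forall>x\<in>S2. f x = h (ai_dist c x (proj_S2 S))"
proof -
  define d where "d x = ai_dist c x (proj_S2 S)" for x
  have eq: "f x = f y" if x: "x \<in> S2" and y: "y \<in> S2" and dist: "d x = d y" for x y
  proof -
    obtain G where G: "det G = 1" "cong_act G (proj_S2 S) = proj_S2 S" "cong_act G x = y"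
      using two_point_homogeneous[OF x y proj_S2_mem[OF S], of c] c dist by (auto simp: d_def)
    \<comment> \<open>The projection rescales \<open>S\<close> by a nonzero factor, so a matrix
      fixing the projected point also fixes \<open>S\<close> itself.\<close>
    have "norm (det S) powr (- 1 / 2) \<noteq> 0"
      using P2_det_nonzero[OF S] by simp
    moreover have "norm (det S) powr (- 1 / 2) *\<^sub>R cong_act G S = norm (det S) powr (- 1 / 2) *\<^sub>R S"
      using G(2) by (simp only: proj_S2_def matrix_mul_scaleR)
    ultimately have "cong_act G S = S"
      by (simp only: scaleR_cancel_left) simp
    then show ?thesis
      using pw_density_stabilizer_invariant[OF S \<nu> f G(1) _ x] G(3) by simp
  qed
  \<comment> \<open>By \<open>eq\<close> any point with \<open>d x = t\<close> gives the same value,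
    so the choice is harmless; values of t that \<open>d\<close> does not attain on
    \<open>S2\<close> receive 0, which keeps \<open>h\<close> nonnegative.\<close>
  define h where "h t = (if \<exists>x\<in>S2. d x = t then f (SOME x. x \<in> S2 \<and> d x = t) else 0)" for t
  have h: "h (d x) = f x" if "x \<in> S2" for x
  proof -
    have "(SOME y. y \<in> S2 \<and> d y = d x) \<in> S2 \<and> d (SOME y. y \<in> S2 \<and> d y = d x) = d x"
      by (rule someI[of _ x]) (simp add: that)
    then have "f (SOME y. y \<in> S2 \<and> d y = d x) = f x"
      by (intro eq that) simp_all
    moreover have "\<exists>y\<in>S2. d y = d x"
      using that by blast
    ultimately show ?thesis
      by (simp only: h_def if_True)
  qed
  show ?thesis
  proof (rule that)
    show "\<forall>t\<ge>0. h t \<ge> 0"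
    proof (intro allI impI)
      fix t :: real
      show "h t \<ge> 0"
      proof (cases "\<exists>x\<in>S2. d x = t")
        case True
        then obtain x where "x \<in> S2" "d x = t" by blast
        with h[of x] show ?thesis
          using pw_density_nonneg[OF \<nu> f] by simp
      qed (simp add: h_def)
    qed
    show "\<forall>x\<in>S2. f x = h (ai_dist c x (proj_S2 S))"
      using h by (simp add: d_def)
  qed
qed

theorem theorem2:
  fixes n :: nat and c :: real
  assumes "n \<ge> 2" and "c > 0"
  shows
    "(\<forall>(\<Sigma> :: real^2^2) \<nu> f.
        \<Sigma> \<in> P2 \<and> invariant_volume \<nu> \<and> pw_density \<nu> \<Sigma> n f \<longrightarrow>
        (\<exists>h :: real \<Rightarrow> real. (\<forall>t\<ge>0. h t \<ge> 0) \<and>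
           (\<forall>x\<in>S2. f x = h (ai_dist c x (proj_S2 \<Sigma>))))) \<and>
     (\<forall>(\<Sigma> :: complex^2^2) \<nu> f.
        \<Sigma> \<in> P2 \<and> invariant_volume \<nu> \<and> pw_density \<nu> \<Sigma> n f \<longrightarrow>
        (\<exists>h :: real \<Rightarrow> real. (\<forall>t\<ge>0. h t \<ge> 0) \<and>
           (\<forall>x\<in>S2. f x = h (ai_dist c x (proj_S2 \<Sigma>)))))"
  by (intro conjI allI impI; elim conjE; erule (2) pw_density_factors_through_dist[OF _ _ _ assms(2)]; blast)

end
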